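(* Let $K\in\{1,-1\}$, let $\Sigma\subset\mathbb{R}^3$ be the unit sphere (if $K=1$) or the upper sheet of the hyperboloid $\{x_1^2+x_2^2-x_3^2=-1\}$ with the metric induced by $dx_1^2+dx_2^2-dx_3^2$ (if $K=-1$), and let $\Omega\subset\Sigma$ be a convex domain. Let $\gamma$ be a smooth regular non-geodesic arc of the boundary of $\Omega$ and let $\Gamma$ be its dual curve, $\Gamma(s)=\gamma(s)\wedge\dot\gamma(s)$. Assume that the Birkhoff billiard in $\Omega$ admits a polynomial integral $\Phi$ of even degree $n$. Then there exists a homogeneous polynomial $\Psi$ on $\mathbb{R}^3$ of degree $n$, not identically zero, which vanishes on $\Gamma$ and satisfies the following: for any point $M\in\Gamma$ and any nonzero tangent vector $w\in T_M\Gamma$, $$\Psi(M-\varepsilon w)=\Psi(M+\varepsilon w)$$ for all sufficiently small $\varepsilon$.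
   Context: For $K=1$ the unit sphere carries the metric induced from Euclidean $\mathbb{R}^3$. Birkhoff billiard inside $\Omega\subset\Sigma$: a point moves with unit speed along geodesics of $\Sigma$ inside $\Omega$ and, on hitting the boundary, is reflected by the law of geometric optics (the tangential component of the velocity is preserved and the normal component changes sign). A polynomial integral is a non-constant function $\Phi$ on the unit tangent bundle $T_1\Omega$ which is polynomial in the velocity $v$ (with coefficients depending on the position $r$) and keeps constant values along the orbits of the billiard flow; its degree is its degree as a polynomial in $v$. The arc $\gamma$ is positively oriented and parametrized by arc length $s$ with respect to the metric of $\Sigma$; $\wedge$ is the standard vector product in $\mathbb{R}^3$. The dual curve is $\Gamma(s)=\gamma(s)\wedge\dot\gamma(s)\in\mathbb{R}^3$; it lies on the unit sphere if $K=1$ and on the one-sheeted hyperboloid $\{x_1^2+x_2^2-x_3^2=1\}$ if $K=-1$. At $M=\Gamma(s)$, $T_M\Gamma$ is spanned by $\dot\Gamma(s)$. *)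

theory Defs
  imports "HOL-Analysis.Analysis"
begin

section \<open>The surfaces of constant curvature\<close>

definition form :: "real \<Rightarrow> real^3 \<Rightarrow> real^3 \<Rightarrow> real" where
  "form K x y = x$1 * y$1 + x$2 * y$2 + K * (x$3 * y$3)"

definition surface :: "real \<Rightarrow> (real^3) set" where
  "surface K = {x. form K x x = K \<and> (K = -1 \<longrightarrow> x$3 > 0)}"

definition unit_tangent_bundle :: "real \<Rightarrow> (real^3) set \<Rightarrow> ((real^3) \<times> (real^3)) set" where
  "unit_tangent_bundle K \<Omega> = {(r, v). r \<in> \<Omega> \<and> form K r v = 0 \<and> form K v v = 1}"

text \<open>At a point \<open>r\<close> of the surface the normal direction with respect to \<open>form K\<close> is spanned by
  \<open>r\<close> itself. Hence the covariant acceleration of a curve on the surface vanishes iff its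
  second derivative in \<open>\<real>\<^sup>3\<close> is a multiple of the position.\<close>

definition geodesic_on :: "real \<Rightarrow> real set \<Rightarrow> (real \<Rightarrow> real^3) \<Rightarrow> bool" where
  "geodesic_on K I c \<longleftrightarrow> c ` I \<subseteq> surface K \<and>
     (\<exists>u. \<forall>t\<in>I. (c has_vector_derivative u t) (at t within I) \<and> form K (u t) (u t) = 1 \<and>
        (\<exists>l. (u has_vector_derivative l *\<^sub>R c t) (at t within I)))"

text \<open>A geodesic segment (parametrized by arc length) on the sphere is the unique shortest path
  between its endpoints iff its length is less than \<open>\<pi>\<close>; on the hyperbolic plane every
  geodesic segment is.\<close>

definition geodesically_convex :: "real \<Rightarrow> (real^3) set \<Rightarrow> bool" where
  "geodesically_convex K \<Omega> \<longleftrightarrow>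
     (\<forall>c a b. a < b \<and> (K = 1 \<longrightarrow> b - a < pi) \<and> geodesic_on K {a..b} c \<and> c a \<in> \<Omega> \<and> c b \<in> \<Omega>
        \<longrightarrow> c ` {a..b} \<subseteq> \<Omega>)"

definition convex_domain :: "real \<Rightarrow> (real^3) set \<Rightarrow> bool" where
  "convex_domain K \<Omega> \<longleftrightarrow> \<Omega> \<noteq> {} \<and> openin (top_of_set (surface K)) \<Omega> \<and> connected \<Omega> \<and>
     geodesically_convex K \<Omega>"

definition boundary :: "real \<Rightarrow> (real^3) set \<Rightarrow> (real^3) set" where
  "boundary K \<Omega> = top_of_set (surface K) frontier_of \<Omega>"

section \<open>Boundary arcs and the dual curve\<close>

definition smooth_curve :: "real set \<Rightarrow> (real \<Rightarrow> real^3) \<Rightarrow> bool" where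
  "smooth_curve I \<gamma> \<longleftrightarrow>
     (\<exists>D. D 0 = \<gamma> \<and> (\<forall>k. \<forall>t\<in>I. (D k has_vector_derivative D (Suc k) t) (at t within I)))"

text \<open>The parameter interval may be open, half-open or closed; at its endpoints derivatives are
  one-sided. Arcs are parametrized by arc length, so they are regular.\<close>

definition boundary_arc :: "real \<Rightarrow> (real^3) set \<Rightarrow> real set \<Rightarrow> (real \<Rightarrow> real^3) \<Rightarrow> bool" where
  "boundary_arc K \<Omega> I \<gamma> \<longleftrightarrow> is_interval I \<and> interior I \<noteq> {} \<and> smooth_curve I \<gamma> \<and>
     \<gamma> ` I \<subseteq> boundary K \<Omega> \<and>
     (\<forall>s\<in>I. form K (vector_derivative \<gamma> (at s within I)) (vector_derivative \<gamma> (at s within I)) = 1)"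

definition dual_curve :: "real set \<Rightarrow> (real \<Rightarrow> real^3) \<Rightarrow> real \<Rightarrow> real^3" where
  "dual_curve I \<gamma> s = cross3 (\<gamma> s) (vector_derivative \<gamma> (at s within I))"

text \<open>The plane spanned by \<open>\<gamma> s\<close> and the velocity cuts the surface in the tangent geodesic, and
  the Euclidean inner product with \<open>dual_curve I \<gamma> s\<close> is positive to the left of it
  (also for \<open>K = -1\<close>). Positive orientation of an arc of the boundary of a convex domain means
  that the domain lies to the left.\<close>

definition positively_oriented :: "(real^3) set \<Rightarrow> real set \<Rightarrow> (real \<Rightarrow> real^3) \<Rightarrow> bool" where
  "positively_oriented \<Omega> I \<gamma> \<longleftrightarrow> (\<forall>s\<in>I. \<forall>x\<in>\<Omega>. dual_curve I \<gamma> s \<bullet> x > 0)"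

section \<open>Birkhoff billiard\<close>

definition boundary_tangent :: "real \<Rightarrow> (real^3) set \<Rightarrow> real^3 \<Rightarrow> real^3 \<Rightarrow> bool" where
  "boundary_tangent K \<Omega> p \<tau> \<longleftrightarrow>
     (\<exists>I \<beta> s. boundary_arc K \<Omega> I \<beta> \<and> s \<in> interior I \<and> \<beta> s = p \<and>
        vector_derivative \<beta> (at s within I) = \<tau>)"

text \<open>For tangent vectors at \<open>p\<close> and a unit vector \<open>\<tau>\<close> tangent to the boundary:
  \<open>v = a \<tau> + b \<nu>\<close> (with \<open>\<nu>\<close> normal to the boundary) goes to \<open>a \<tau> - b \<nu> = 2 a \<tau> - v\<close>.\<close>

definition reflect :: "real \<Rightarrow> real^3 \<Rightarrow> real^3 \<Rightarrow> real^3" where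
  "reflect K \<tau> v = (2 * form K v \<tau>) *\<^sub>R \<tau> - v"

text \<open>An orbit moves along geodesics at unit speed while inside the domain and is reflected at
  smooth points of the boundary; it is not continued past non-smooth boundary points.\<close>

definition billiard_orbit :: "real \<Rightarrow> (real^3) set \<Rightarrow> real set \<Rightarrow> (real \<Rightarrow> real^3) \<Rightarrow> bool" where
  "billiard_orbit K \<Omega> J c \<longleftrightarrow>
     is_interval J \<and> open J \<and> continuous_on J c \<and> c ` J \<subseteq> \<Omega> \<union> boundary K \<Omega> \<and>
     (\<forall>t\<in>J. c t \<in> \<Omega> \<longrightarrow> (\<exists>\<delta>>0. geodesic_on K {t-\<delta><..<t+\<delta>} c)) \<and>
     (\<forall>t\<in>J. c t \<in> boundary K \<Omega> \<longrightarrow>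
        (\<exists>\<delta>>0. \<exists>v \<tau>. c ` ({t-\<delta><..<t+\<delta>} - {t}) \<subseteq> \<Omega> \<and>
           geodesic_on K {t-\<delta><..t} c \<and> geodesic_on K {t..<t+\<delta>} c \<and>
           boundary_tangent K \<Omega> (c t) \<tau> \<and>
           (c has_vector_derivative v) (at_left t) \<and>
           (c has_vector_derivative reflect K \<tau> v) (at_right t)))"

section \<open>Polynomials and polynomial integrals\<close>

definition polynomial_le :: "nat \<Rightarrow> (real^3 \<Rightarrow> real) \<Rightarrow> bool" where
  "polynomial_le d P \<longleftrightarrow>
     (\<exists>a. \<forall>x. P x = (\<Sum>i\<le>d. \<Sum>j\<le>d-i. \<Sum>k\<le>d-i-j. a i j k * x$1^i * x$2^j * x$3^k))"

definition homogeneous_polynomial :: "nat \<Rightarrow> (real^3 \<Rightarrow> real) \<Rightarrow> bool" where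
  "homogeneous_polynomial n P \<longleftrightarrow>
     (\<exists>a. \<forall>x. P x = (\<Sum>i\<le>n. \<Sum>j\<le>n-i. a i j * x$1^i * x$2^j * x$3^(n-i-j)))"

text \<open>Polynomials in the ambient coordinates of \<open>v\<close> restrict on each tangent plane to exactly the
  polynomials in linear coordinates of that plane, with the same bound on the degree.\<close>

definition polynomial_in_velocity ::
    "real \<Rightarrow> (real^3) set \<Rightarrow> nat \<Rightarrow> (real^3 \<Rightarrow> real^3 \<Rightarrow> real) \<Rightarrow> bool" where
  "polynomial_in_velocity K \<Omega> d \<Phi> \<longleftrightarrow>
     (\<exists>P. (\<forall>r\<in>\<Omega>. polynomial_le d (P r)) \<and>
          (\<forall>(r, v)\<in>unit_tangent_bundle K \<Omega>. \<Phi> r v = P r v))"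

text \<open>Since \<open>form K v v = 1\<close> on the unit tangent bundle, the polynomial in \<open>v\<close> representing a
  function there is not unique and can be given artificially high degree. The degree of the
  function is the least possible one.\<close>

definition polynomial_integral ::
    "real \<Rightarrow> (real^3) set \<Rightarrow> nat \<Rightarrow> (real^3 \<Rightarrow> real^3 \<Rightarrow> real) \<Rightarrow> bool" where
  "polynomial_integral K \<Omega> n \<Phi> \<longleftrightarrow>
     \<not> (\<exists>C. \<forall>(r, v)\<in>unit_tangent_bundle K \<Omega>. \<Phi> r v = C) \<and>
     polynomial_in_velocity K \<Omega> n \<Phi> \<and> (\<forall>m<n. \<not> polynomial_in_velocity K \<Omega> m \<Phi>) \<and>
     (\<forall>J c. billiard_orbit K \<Omega> J c \<longrightarrow>
        (\<forall>s\<in>J. \<forall>t\<in>J. c s \<in> \<Omega> \<longrightarrow> c t \<in> \<Omega> \<longrightarrow>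
           \<Phi> (c s) (vector_derivative c (at s)) = \<Phi> (c t) (vector_derivative c (at t))))"

end

theory Submission
  imports Defs
begin

text \<open>A geodesic is determined by its momentum \<open>M = r \<and> v\<close>, and the even part of \<open>\<Phi>\<close> in \<open>v\<close> depends
  on \<open>M\<close> only. On the plane \<open>M \<bottom> r\<close> it is a form of degree \<open>n\<close> for every \<open>r\<close> of the open set \<open>\<Omega>\<close>;
  since no regularity in \<open>r\<close> is available, these forms are glued to one form \<open>P\<close> on \<open>\<real>\<^sup>3\<close> by
  interpolation. The even part cannot be constant, because the odd part of \<open>\<Phi>\<close> has degree less than \<open>n\<close>.
  At \<open>p = \<gamma>(s)\<close> the reflection law exchanges the directions of the momenta \<open>\<Gamma> \<plusminus> \<epsilon> \<Gamma>'\<close>, up to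
  sign, so \<open>P(\<Gamma> + \<epsilon> \<Gamma>') = P(\<Gamma> - \<epsilon> \<Gamma>')\<close>. Differentiating in \<open>\<epsilon>\<close> shows that \<open>P\<close> equals a constant \<open>c\<close>
  on \<open>\<Gamma>\<close>. As the quadratic form \<open>Q\<close> is \<open>1\<close> on \<open>\<Gamma>\<close> and even along its tangents,
  \<open>P - c Q\<^bsup>n/2\<^esup>\<close> is the required polynomial.\<close>

section \<open>Homogeneous polynomials\<close>

text \<open>The even part is taken for two reasons. On unit vectors Q is 1, so terms of even degree
  below n can be multiplied by powers of Q and become homogeneous of degree n; odd terms cannot.
  Moreover, a vector pointing into \<Omega> at p is the reverse of an arriving velocity, so the
  reflection law matches momenta only up to sign. Geometry on \<Sigma> is transferred to the cone
  over \<Omega>: the plane with normal \<Gamma> at one point of the arc keeps \<Omega> in an open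
  half-space, which excludes antipodal pairs, and geodesic convexity of \<Omega> becomes ordinary
  convexity of an open cone. Separation of convex sets then shows that the two geodesics matched at
  p do enter \<Omega>. Endpoints of the parameter interval need not be reflection points; there the
  identity follows by continuity. The momentum of a unit vector satisfies Q = 1, so at such momenta
  the final polynomial equals P - c, which is nonzero wherever the even part of \<Phi> differs from
  c.\<close>

lemma homogeneous_polynomial_add:
  assumes "homogeneous_polynomial n P" "homogeneous_polynomial n Q"
  shows "homogeneous_polynomial n (\<lambda>x. P x + Q x)"
proof -
  obtain a b where "\<forall>x. P x = (\<Sum>i\<le>n. \<Sum>j\<le>n-i. a i j * x$1^i * x$2^j * x$3^(n-i-j))"
    "\<forall>x. Q x = (\<Sum>i\<le>n. \<Sum>j\<le>n-i. b i j * x$1^i * x$2^j * x$3^(n-i-j))"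
    using assms unfolding homogeneous_polynomial_def by blast
  then show ?thesis
    unfolding homogeneous_polynomial_def
    by (intro exI[of _ "\<lambda>i j. a i j + b i j"]) (simp add: sum.distrib distrib_right)
qed

lemma homogeneous_polynomial_cmult:
  assumes "homogeneous_polynomial n P"
  shows "homogeneous_polynomial n (\<lambda>x. c * P x)"
proof -
  obtain a where "\<forall>x. P x = (\<Sum>i\<le>n. \<Sum>j\<le>n-i. a i j * x$1^i * x$2^j * x$3^(n-i-j))"
    using assms unfolding homogeneous_polynomial_def by blast
  then show ?thesis
    unfolding homogeneous_polynomial_def
    by (intro exI[of _ "\<lambda>i j. c * a i j"]) (simp add: sum_distrib_left mult_ac)
qed

lemma homogeneous_polynomial_0: "homogeneous_polynomial n (\<lambda>x. 0)"
  unfolding homogeneous_polynomial_def by (intro exI[of _ "\<lambda>i j. 0"]) simp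

lemma homogeneous_polynomial_sum:
  assumes "\<And>i. i \<in> A \<Longrightarrow> homogeneous_polynomial n (P i)"
  shows "homogeneous_polynomial n (\<lambda>x. \<Sum>i\<in>A. P i x)"
  using assms
  by (induction A rule: infinite_finite_induct)
    (auto intro: homogeneous_polynomial_0 homogeneous_polynomial_add)

lemma homogeneous_polynomial_const: "homogeneous_polynomial 0 (\<lambda>x. c)"
  unfolding homogeneous_polynomial_def by (intro exI[of _ "\<lambda>i j. c"]) simp

lemma homogeneous_polynomial_mult_coordinate:
  assumes "homogeneous_polynomial n P"
  shows "homogeneous_polynomial (Suc n) (\<lambda>x. x $ m * P x)"
proof -
  obtain a where a: "\<forall>x. P x = (\<Sum>i\<le>n. \<Sum>j\<le>n-i. a i j * x$1^i * x$2^j * x$3^(n-i-j))"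
    using assms unfolding homogeneous_polynomial_def by blast
  consider "m = 1" | "m = 2" | "m = 3" using exhaust_3 by blast
  then show ?thesis
  proof cases
    case 1
    have "x$1 * P x = (\<Sum>i\<le>Suc n. \<Sum>j\<le>Suc n - i.
      (if i = 0 then 0 else a (i - 1) j) * x$1^i * x$2^j * x$3^(Suc n-i-j))" for x
      unfolding sum.atMost_Suc_shift[of _ n] by (simp add: a sum_distrib_left mult_ac)
    then show ?thesis using 1 unfolding homogeneous_polynomial_def
      by (intro exI[of _ "\<lambda>i j. if i = 0 then 0 else a (i - 1) j"]) simp
  next
    case 2
    have "x$2 * P x = (\<Sum>i\<le>Suc n. \<Sum>j\<le>Suc n - i.
      (if j = 0 then 0 else a i (j - 1)) * x$1^i * x$2^j * x$3^(Suc n-i-j))" for x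
    proof -
      have "(\<Sum>j\<le>Suc n - i.
        (if j = 0 then 0 else a i (j - 1)) * x$1^i * x$2^j * x$3^(Suc n-i-j))
        = x$2 * (\<Sum>j\<le>n - i. a i j * x$1^i * x$2^j * x$3^(n-i-j))" if "i \<le> n" for i
        unfolding Suc_diff_le[OF that] sum.atMost_Suc_shift[of _ "n - i"]
        by (simp add: sum_distrib_left mult_ac)
      then show ?thesis by (simp add: a sum_distrib_left)
    qed
    then show ?thesis using 2 unfolding homogeneous_polynomial_def
      by (intro exI[of _ "\<lambda>i j. if j = 0 then 0 else a i (j - 1)"]) simp
  next
    case 3
    \<comment> \<open>The exponent of \<open>x$3\<close> is implicit in the representation, so no
      index is shifted. Only the pairs with i + j = n + 1 are new, and their coefficient is
      0.\<close>
    have "x$3 * P x = (\<Sum>i\<le>Suc n. \<Sum>j\<le>Suc n - i.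
      (if i + j \<le> n then a i j else 0) * x$1^i * x$2^j * x$3^(Suc n-i-j))" for x
    proof -
      have "(\<Sum>j\<le>Suc n - i.
        (if i + j \<le> n then a i j else 0) * x$1^i * x$2^j * x$3^(Suc n-i-j))
        = x$3 * (\<Sum>j\<le>n - i. a i j * x$1^i * x$2^j * x$3^(n-i-j))" if "i \<le> n" for i
      proof -
        have "(\<Sum>j\<le>n - i. (if i + j \<le> n then a i j else 0) * x$1^i * x$2^j * x$3^(Suc n-i-j))
          = (\<Sum>j\<le>n - i. x$3 * (a i j * x$1^i * x$2^j * x$3^(n-i-j)))"
          using that by (intro sum.cong) (auto simp: Suc_diff_le mult_ac)
        then show ?thesis using that by (simp add: Suc_diff_le sum_distrib_left)
      qed
      then show ?thesis by (simp add: a sum_distrib_left)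
    qed
    then show ?thesis using 3 unfolding homogeneous_polynomial_def
      by (intro exI[of _ "\<lambda>i j. if i + j \<le> n then a i j else 0"]) simp
  qed
qed

lemma homogeneous_polynomial_mult_coordinate_power:
  assumes "homogeneous_polynomial n P"
  shows "homogeneous_polynomial (n + k) (\<lambda>x. x $ m ^ k * P x)"
proof (induction k)
  case (Suc k)
  from homogeneous_polynomial_mult_coordinate[OF this, of m] show ?case
    by (simp add: mult_ac)
qed (use assms in simp)

lemma homogeneous_polynomial_mult:
  assumes P: "homogeneous_polynomial n P" and Q: "homogeneous_polynomial m Q"
  shows "homogeneous_polynomial (n + m) (\<lambda>x. P x * Q x)"
proof -
  obtain a where a: "\<forall>x. Q x = (\<Sum>i\<le>m. \<Sum>j\<le>m-i. a i j * x$1^i * x$2^j * x$3^(m-i-j))"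
    using Q unfolding homogeneous_polynomial_def by blast
  have "homogeneous_polynomial (n + m)
    (\<lambda>x. \<Sum>i\<le>m. \<Sum>j\<le>m-i. a i j * (x$1^i * (x$2^j * (x$3^(m-i-j) * P x))))"
  proof (intro homogeneous_polynomial_sum homogeneous_polynomial_cmult)
    fix i j assume "i \<in> {..m}" "j \<in> {..m-i}"
    then have "n + m = n + (m - i - j) + j + i" by simp
    then show "homogeneous_polynomial (n + m) (\<lambda>x. x$1^i * (x$2^j * (x$3^(m-i-j) * P x)))"
      by (simp only:) (intro homogeneous_polynomial_mult_coordinate_power P)
  qed
  then show ?thesis by (simp add: a sum_distrib_left mult_ac)
qed

lemma homogeneous_polynomial_coordinate: "homogeneous_polynomial 1 (\<lambda>x. x $ m)"
  using homogeneous_polynomial_mult_coordinate[OF homogeneous_polynomial_const[of 1], of m] by simp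

lemma homogeneous_polynomial_inner: "homogeneous_polynomial 1 (\<lambda>x. a \<bullet> x)"
proof -
  have "(\<lambda>x. a \<bullet> x) = (\<lambda>x. \<Sum>i\<in>UNIV. a $ i * x $ i)"
    by (simp add: inner_vec_def)
  then show ?thesis
    by (simp only:) (intro homogeneous_polynomial_sum homogeneous_polynomial_cmult
        homogeneous_polynomial_coordinate)
qed

lemma homogeneous_polynomial_prod:
  assumes "finite A" "\<And>i. i \<in> A \<Longrightarrow> homogeneous_polynomial (d i) (P i)"
  shows "homogeneous_polynomial (\<Sum>i\<in>A. d i) (\<lambda>x. \<Prod>i\<in>A. P i x)"
  using assms
  by (induction A) (auto intro: homogeneous_polynomial_const homogeneous_polynomial_mult)

lemma homogeneous_polynomial_power:
  assumes "homogeneous_polynomial n P"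
  shows "homogeneous_polynomial (n * k) (\<lambda>x. P x ^ k)"
  using homogeneous_polynomial_prod[of "{..<k}" "\<lambda>_. n" "\<lambda>_. P"] assms by (simp add: mult.commute)

lemma homogeneous_polynomial_form: "homogeneous_polynomial 2 (\<lambda>x. form K x x)"
proof -
  have "homogeneous_polynomial (1 + 1) (\<lambda>x. x$1 * x$1 + x$2 * x$2 + K * (x$3 * x$3))"
    by (intro homogeneous_polynomial_add homogeneous_polynomial_cmult homogeneous_polynomial_mult
        homogeneous_polynomial_coordinate)
  then show ?thesis by (simp add: form_def numeral_2_eq_2)
qed

lemma homogeneous_polynomial_comp_linear:
  assumes P: "homogeneous_polynomial n P" and L: "linear L"
  shows "homogeneous_polynomial n (\<lambda>x. P (L x))"
proof -
  obtain a where a: "\<forall>x. P x = (\<Sum>i\<le>n. \<Sum>j\<le>n-i. a i j * x$1^i * x$2^j * x$3^(n-i-j))"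
    using P unfolding homogeneous_polynomial_def by blast
  have *: "homogeneous_polynomial (1 * k) (\<lambda>x. L x $ m ^ k)" for m k
  proof -
    have "(\<lambda>x. L x $ m) = (\<lambda>x. adjoint L (axis m 1) \<bullet> x)"
      using adjoint_works[OF L] by (auto simp: inner_axis inner_commute fun_eq_iff)
    then have "homogeneous_polynomial 1 (\<lambda>x. L x $ m)"
      using homogeneous_polynomial_inner by simp
    then show ?thesis by (rule homogeneous_polynomial_power)
  qed
  have "homogeneous_polynomial n
    (\<lambda>x. \<Sum>i\<le>n. \<Sum>j\<le>n-i. a i j * (L x$1^i * L x$2^j * L x$3^(n-i-j)))"
  proof (intro homogeneous_polynomial_sum homogeneous_polynomial_cmult)
    fix i j assume "i \<in> {..n}" "j \<in> {..n-i}"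
    then have "n = 1 * i + 1 * j + 1 * (n - i - j)" by simp
    moreover have "homogeneous_polynomial (1 * i + 1 * j + 1 * (n - i - j))
      (\<lambda>x. L x$1^i * L x$2^j * L x$3^(n-i-j))"
      by (intro homogeneous_polynomial_mult *)
    ultimately show "homogeneous_polynomial n (\<lambda>x. L x$1^i * L x$2^j * L x$3^(n-i-j))"
      by simp
  qed
  then show ?thesis by (simp add: a mult_ac)
qed

lemma homogeneous_polynomial_scaleR:
  assumes "homogeneous_polynomial n P"
  shows "P (c *\<^sub>R x) = c ^ n * P x"
proof -
  obtain a where a: "\<forall>x. P x = (\<Sum>i\<le>n. \<Sum>j\<le>n-i. a i j * x$1^i * x$2^j * x$3^(n-i-j))"
    using assms unfolding homogeneous_polynomial_def by blast
  have "a i j * (c * x$1)^i * (c * x$2)^j * (c * x$3)^(n-i-j) =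
      c ^ n * (a i j * x$1^i * x$2^j * x$3^(n-i-j))" if "i \<le> n" "j \<le> n - i" for i j
  proof -
    have "c ^ n = c ^ i * c ^ j * c ^ (n - i - j)"
      using that by (simp flip: power_add)
    then show ?thesis by (simp add: power_mult_distrib mult_ac)
  qed
  then show ?thesis
    unfolding a[rule_format] sum_distrib_left vector_scaleR_component real_scaleR_def
    by (intro sum.cong) auto
qed

lemma homogeneous_polynomial_on_line:
  assumes "homogeneous_polynomial n P"
  obtains q where "degree q \<le> n" "\<And>t. P (x + t *\<^sub>R y) = poly q t"
proof -
  obtain a where a: "\<forall>x. P x = (\<Sum>i\<le>n. \<Sum>j\<le>n-i. a i j * x$1^i * x$2^j * x$3^(n-i-j))"
    using assms unfolding homogeneous_polynomial_def by blast
  define l where "l m = [:x $ m, y $ m:]" for m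
  define q where "q = (\<Sum>i\<le>n. \<Sum>j\<le>n-i. smult (a i j) (l 1 ^ i * l 2 ^ j * l 3 ^ (n-i-j)))"
  have l: "degree (l m ^ k) \<le> k" for m k
    using degree_power_le[of "l m" k] by (simp add: l_def split: if_splits)
  have "degree (smult (a i j) (l 1 ^ i * l 2 ^ j * l 3 ^ (n-i-j))) \<le> n"
    if "i \<le> n" "j \<le> n - i" for i j
  proof -
    have "degree (l 1 ^ i * l 2 ^ j * l 3 ^ (n-i-j)) \<le> i + j + (n - i - j)"
      using l by (intro order.trans[OF degree_mult_le] add_mono) auto
    also have "\<dots> = n" using \<open>i \<le> n\<close> \<open>j \<le> n - i\<close> by simp
    finally show ?thesis using degree_smult_le order.trans by blast
  qed
  then have "degree q \<le> n"
    unfolding q_def by (intro degree_sum_le) auto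
  moreover have "P (x + t *\<^sub>R y) = poly q t" for t
    by (simp add: a q_def l_def poly_sum mult_ac)
  ultimately show ?thesis using that by blast
qed

lemma homogeneous_polynomial_differentiable:
  assumes "homogeneous_polynomial n P"
  shows "P differentiable (at x)"
proof -
  obtain a where a: "\<forall>x. P x = (\<Sum>i\<le>n. \<Sum>j\<le>n-i. a i j * x$1^i * x$2^j * x$3^(n-i-j))"
    using assms unfolding homogeneous_polynomial_def by blast
  have "(\<lambda>x::real^3. x $ m) differentiable (at x)" for m
    by (simp add: bounded_linear_imp_differentiable bounded_linear_vec_nth)
  then have "(\<lambda>x. \<Sum>i\<le>n. \<Sum>j\<le>n-i. a i j * x$1^i * x$2^j * x$3^(n-i-j)) differentiable (at x)"
    by (intro differentiable_sum differentiable_mult differentiable_power differentiable_const) auto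
  then show ?thesis using a by (simp add: fun_eq_iff[symmetric] cong del: if_weak_cong)
qed

section \<open>Decomposition by degree, even and odd parts\<close>

lemma sum_by_total_degree:
  fixes f :: "nat \<Rightarrow> nat \<Rightarrow> nat \<Rightarrow> 'a::comm_monoid_add"
  shows "(\<Sum>i\<le>d. \<Sum>j\<le>d-i. \<Sum>k\<le>d-i-j. f i j k) = (\<Sum>m\<le>d. \<Sum>i\<le>m. \<Sum>j\<le>m-i. f i j (m-i-j))"
proof -
  have "(\<Sum>i\<le>d. \<Sum>j\<le>d-i. \<Sum>k\<le>d-i-j. f i j k)
      = (\<Sum>(i, j, k)\<in>(SIGMA i:{..d}. SIGMA j:{..d-i}. {..d-i-j}). f i j k)"
    by (simp add: sum.Sigma)
  also have "\<dots> = (\<Sum>(m, i, j)\<in>(SIGMA m:{..d}. SIGMA i:{..m}. {..m-i}). f i j (m-i-j))"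
    by (rule sum.reindex_bij_witness[of _ "\<lambda>(m,i,j). (i,j,m-i-j)" "\<lambda>(i,j,k). (i+j+k,i,j)"]) auto
  also have "\<dots> = (\<Sum>m\<le>d. \<Sum>i\<le>m. \<Sum>j\<le>m-i. f i j (m-i-j))"
    by (simp add: sum.Sigma)
  finally show ?thesis .
qed

lemma polynomial_le_iff_sum_homogeneous:
  "polynomial_le d P \<longleftrightarrow> (\<exists>h. (\<forall>m\<le>d. homogeneous_polynomial m (h m)) \<and> P = (\<lambda>x. \<Sum>m\<le>d. h m x))"
proof
  assume "polynomial_le d P"
  then obtain a where "\<forall>x. P x = (\<Sum>i\<le>d. \<Sum>j\<le>d-i. \<Sum>k\<le>d-i-j. a i j k * x$1^i * x$2^j * x$3^k)"
    unfolding polynomial_le_def by blast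
  then have "P x = (\<Sum>m\<le>d. \<Sum>i\<le>m. \<Sum>j\<le>m-i. a i j (m-i-j) * x$1^i * x$2^j * x$3^(m-i-j))" for x
    by (simp only: sum_by_total_degree)
  moreover have "homogeneous_polynomial m
      (\<lambda>x. \<Sum>i\<le>m. \<Sum>j\<le>m-i. a i j (m-i-j) * x$1^i * x$2^j * x$3^(m-i-j))" for m
    unfolding homogeneous_polynomial_def by (intro exI[of _ "\<lambda>i j. a i j (m-i-j)"]) simp
  ultimately show "\<exists>h. (\<forall>m\<le>d. homogeneous_polynomial m (h m)) \<and> P = (\<lambda>x. \<Sum>m\<le>d. h m x)"
    by (intro exI[of _ "\<lambda>m x. \<Sum>i\<le>m. \<Sum>j\<le>m-i. a i j (m-i-j) * x$1^i * x$2^j * x$3^(m-i-j)"]) auto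
next
  assume "\<exists>h. (\<forall>m\<le>d. homogeneous_polynomial m (h m)) \<and> P = (\<lambda>x. \<Sum>m\<le>d. h m x)"
  then obtain h where h: "\<And>m. m \<le> d \<Longrightarrow> homogeneous_polynomial m (h m)" "P = (\<lambda>x. \<Sum>m\<le>d. h m x)"
    by blast
  have "\<forall>m. \<exists>a. m \<le> d \<longrightarrow> (\<forall>x. h m x = (\<Sum>i\<le>m. \<Sum>j\<le>m-i. a i j * x$1^i * x$2^j * x$3^(m-i-j)))"
    using h(1) unfolding homogeneous_polynomial_def by blast
  then obtain a where a: "\<And>m x. m \<le> d \<Longrightarrow>
      h m x = (\<Sum>i\<le>m. \<Sum>j\<le>m-i. a m i j * x$1^i * x$2^j * x$3^(m-i-j))"
    using choice[of "\<lambda>m a. m \<le> d \<longrightarrow>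
      (\<forall>x. h m x = (\<Sum>i\<le>m. \<Sum>j\<le>m-i. a i j * x$1^i * x$2^j * x$3^(m-i-j)))"] by blast
  \<comment> \<open>The index \<open>i+j+(m-i-j)\<close> equals m in this range. Written this way,
    the coefficient depends on the three exponents only, as the regrouping of the sum
    requires.\<close>
  have "P x = (\<Sum>m\<le>d. \<Sum>i\<le>m. \<Sum>j\<le>m-i. a (i+j+(m-i-j)) i j * x$1^i * x$2^j * x$3^(m-i-j))" for x
    unfolding h(2) by (intro sum.cong) (auto simp: a intro!: sum.cong)
  then show "polynomial_le d P"
    unfolding polynomial_le_def
    by (intro exI[of _ "\<lambda>i j k. a (i+j+k) i j"]) (simp only: sum_by_total_degree simp_thms)
qed

text \<open>The odd terms cancel. An even term of degree m < n is multiplied by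
  \<open>form K v v\<close> to the power (n - m) / 2, which changes nothing on unit vectors; n - m
  is even because n is.\<close>

lemma polynomial_le_even_part:
  assumes "polynomial_le n P" "even n"
  obtains h where "homogeneous_polynomial n h"
    "\<And>v. form K v v = 1 \<Longrightarrow> h v = (P v + P (- v)) / 2"
proof -
  obtain h where h: "\<And>m. m \<le> n \<Longrightarrow> homogeneous_polynomial m (h m)" "P = (\<lambda>x. \<Sum>m\<le>n. h m x)"
    using assms by (auto simp: polynomial_le_iff_sum_homogeneous)
  define e where "e v = (\<Sum>m\<le>n. if even m then h m v * form K v v ^ ((n - m) div 2) else 0)" for v
  have "homogeneous_polynomial n e" unfolding e_def
  proof (rule homogeneous_polynomial_sum)
    fix m assume m: "m \<in> {..n}"
    have "homogeneous_polynomial n (\<lambda>v. h m v * form K v v ^ ((n - m) div 2))" if "even m"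
    proof -
      have "homogeneous_polynomial (m + 2 * ((n - m) div 2)) (\<lambda>v. h m v * form K v v ^ ((n - m) div 2))"
        using m by (intro homogeneous_polynomial_mult homogeneous_polynomial_power
            homogeneous_polynomial_form h) auto
      moreover have "m + 2 * ((n - m) div 2) = n" using m that \<open>even n\<close> by simp
      ultimately show ?thesis by simp
    qed
    then show "homogeneous_polynomial n (\<lambda>v. if even m then h m v * form K v v ^ ((n - m) div 2) else 0)"
      by (cases "even m") (auto intro: homogeneous_polynomial_0)
  qed
  moreover have "e v = (P v + P (- v)) / 2" if "form K v v = 1" for v
  proof -
    have "h m (- v) = (- 1) ^ m * h m v" if "m \<le> n" for m
      using homogeneous_polynomial_scaleR[OF h(1)[OF that], of "-1" v] by simp
    then have "(P v + P (- v)) / 2 = (\<Sum>m\<le>n. (h m v + (- 1) ^ m * h m v) / 2)"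
      by (simp add: h(2) flip: sum.distrib sum_divide_distrib)
    also have "\<dots> = e v"
      unfolding e_def using that by (intro sum.cong) auto
    finally show ?thesis by simp
  qed
  ultimately show ?thesis using that by blast
qed

text \<open>The terms of even degree cancel, among them the one of degree n. The constant c will be
  the value of an even part assumed to be constant; it occupies degree 0.\<close>

lemma polynomial_le_odd_part:
  assumes "polynomial_le n P" "even n" "n > 0"
  shows "polynomial_le (n - 1) (\<lambda>v. (P v - P (- v)) / 2 + c)"
proof -
  obtain h where h: "\<And>m. m \<le> n \<Longrightarrow> homogeneous_polynomial m (h m)" "P = (\<lambda>x. \<Sum>m\<le>n. h m x)"
    using assms by (auto simp: polynomial_le_iff_sum_homogeneous)
  define g where "g m = (if m = 0 then (\<lambda>_. c) else if odd m then h m else (\<lambda>_. 0))" for m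
  have "homogeneous_polynomial m (g m)" if "m \<le> n - 1" for m
    using that h(1)[of m]
    by (auto simp: g_def intro: homogeneous_polynomial_const homogeneous_polynomial_0)
  moreover have "(P v - P (- v)) / 2 + c = (\<Sum>m\<le>n-1. g m v)" for v
  proof -
    have "h m (- v) = (- 1) ^ m * h m v" if "m \<le> n" for m
      using homogeneous_polynomial_scaleR[OF h(1)[OF that], of "-1" v] by simp
    then have "(P v - P (- v)) / 2 = (\<Sum>m\<le>n. (h m v - (- 1) ^ m * h m v) / 2)"
      by (simp add: h(2) flip: sum_subtractf sum_divide_distrib)
    also have "\<dots> = (\<Sum>m\<le>Suc (n - 1). if odd m then h m v else 0)"
      using \<open>n > 0\<close> by (intro sum.cong) auto
    also have "\<dots> = (\<Sum>m\<le>n-1. if odd m then h m v else 0)"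
      using \<open>n > 0\<close> \<open>even n\<close> by (subst sum.atMost_Suc) simp
    finally show ?thesis
      by (auto simp: g_def sum.atMost_shift intro!: sum.cong)
  qed
  ultimately show ?thesis unfolding polynomial_le_iff_sum_homogeneous by blast
qed

section \<open>Interpolation on planes\<close>

text \<open>Projectively, \<open>cross3 a b\<close> is the intersection of the lines with normals a
  and b. For nonzero a, the identity shows that the line of a meets the other two in distinct points
  exactly if the three are not concurrent.\<close>

lemma cross3_cross3_common:
  "cross3 (cross3 a b) (cross3 a c) = (a \<bullet> cross3 b c) *\<^sub>R a"
  by (simp add: Lagrange dot_cross_self) (metis cross_triple inner_commute)

text \<open>Expansion of p in the orthogonal basis M, \<open>cross3 r M\<close> of the plane
  orthogonal to r, with the common denominator cleared; the squared length of
  \<open>cross3 r M\<close> is the product of those of r and M.\<close>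

lemma orthogonal_plane_expansion:
  fixes r M p :: "real^3"
  assumes "r \<bullet> M = 0" "r \<bullet> p = 0"
  shows "(cross3 r M \<bullet> cross3 r M) *\<^sub>R p
    = (p \<bullet> cross3 r M) *\<^sub>R cross3 r M + ((p \<bullet> M) * (r \<bullet> r)) *\<^sub>R M"
proof -
  let ?N = "cross3 r M"
  have "cross3 p ?N = (p \<bullet> M) *\<^sub>R r"
    using assms by (simp add: Lagrange inner_commute)
  then have "cross3 ?N (cross3 p ?N) = ((p \<bullet> M) * (r \<bullet> r)) *\<^sub>R M"
    using assms cross_skew[of ?N r] by (simp add: cross_mult_right Lagrange inner_commute)
  moreover have "cross3 ?N (cross3 p ?N) = (?N \<bullet> ?N) *\<^sub>R p - (p \<bullet> ?N) *\<^sub>R ?N"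
    using Lagrange[of ?N p ?N] by (simp add: inner_commute)
  ultimately show ?thesis by (simp add: algebra_simps)
qed

text \<open>A nonzero binary form of degree n has at most n projective zeros. To count roots in one
  variable instead, the given zeros are rescaled onto an affine line through M inside the plane, on
  which M has parameter 0.\<close>

lemma homogeneous_polynomial_zero_on_plane:
  fixes s :: "'a \<Rightarrow> real^3"
  assumes P: "homogeneous_polynomial n P" and "finite J" "card J > n" "r \<noteq> 0"
    and s: "\<And>j. j \<in> J \<Longrightarrow> s j \<noteq> 0 \<and> r \<bullet> s j = 0 \<and> P (s j) = 0"
    and indep: "\<And>j k. j \<in> J \<Longrightarrow> k \<in> J \<Longrightarrow> j \<noteq> k \<Longrightarrow> cross3 (s j) (s k) \<noteq> 0"
    and M: "r \<bullet> M = 0" "M \<noteq> 0"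
  shows "P M = 0"
proof -
  define N where "N = cross3 r M"
  define D where "D = N \<bullet> N"
  have "D = (r \<bullet> r) * (M \<bullet> M)"
    using M(1) by (simp add: D_def N_def dot_cross inner_commute)
  then have D: "D > 0" using \<open>r \<noteq> 0\<close> M(2) by simp
  define a where "a j = (s j \<bullet> M) * (r \<bullet> r) / D" for j
  define b where "b j = (s j \<bullet> N) / D" for j
  have sj: "s j = a j *\<^sub>R M + b j *\<^sub>R N" if "j \<in> J" for j
  proof -
    have "D *\<^sub>R s j = (s j \<bullet> N) *\<^sub>R N + ((s j \<bullet> M) * (r \<bullet> r)) *\<^sub>R M"
      unfolding D_def N_def using orthogonal_plane_expansion[OF M(1)] s[OF that] by blast
    then have "(1 / D) *\<^sub>R D *\<^sub>R s j = (1 / D) *\<^sub>R ((s j \<bullet> N) *\<^sub>R N + ((s j \<bullet> M) * (r \<bullet> r)) *\<^sub>R M)"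
      by simp
    then show ?thesis using D by (simp add: a_def b_def scaleR_add_right add.commute)
  qed
  \<comment> \<open>The direction u below must not be parallel to any given zero, which would then
    lie at infinity of the line. If \<open>b j = 0\<close>, the quotient is 0, a harmless exclusion,
    and \<open>c j = a j\<close> is nonzero anyway.\<close>
  obtain t where t: "t \<notin> (\<lambda>j. a j / b j) ` J"
    using ex_new_if_finite[OF infinite_UNIV_char_0] \<open>finite J\<close> by (meson finite_imageI)
  define c where "c j = a j - b j * t" for j
  have c: "c j \<noteq> 0" if "j \<in> J" for j
  proof
    assume "c j = 0"
    then have eq: "a j = b j * t" by (simp add: c_def)
    then have "b j \<noteq> 0" using s[OF that] sj[OF that] by auto
    then show False using t that eq by (auto simp: image_iff field_simps)
  qed
  define u where "u = N + t *\<^sub>R M"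
  define x where "x j = b j / c j" for j
  have sx: "s j = c j *\<^sub>R (M + x j *\<^sub>R u)" if "j \<in> J" for j
  proof -
    have "c j *\<^sub>R (M + x j *\<^sub>R u) = c j *\<^sub>R M + b j *\<^sub>R u"
      using c[OF that] by (simp add: x_def scaleR_add_right)
    then show ?thesis by (simp add: sj[OF that] c_def u_def algebra_simps)
  qed
  obtain q where q: "degree q \<le> n" "\<And>t. P (M + t *\<^sub>R u) = poly q t"
    using homogeneous_polynomial_on_line[OF P] by metis
  have "poly q (x j) = 0" if "j \<in> J" for j
    using s[OF that] c[OF that] q(2)[of "x j"] homogeneous_polynomial_scaleR[OF P, of "c j"]
    by (simp add: sx[OF that])
  then have "x ` J \<subseteq> {t. poly q t = 0}" by auto
  moreover have "inj_on x J"
  proof (rule inj_onI, rule ccontr)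
    fix j k assume "j \<in> J" "k \<in> J" "x j = x k" "j \<noteq> k"
    then show False using indep[of j k] by (simp add: sx cross_mult_left cross_mult_right)
  qed
  then have "card (x ` J) = card J" by (rule card_image)
  ultimately have "q = 0"
    using card_mono[OF poly_roots_finite, of q "x ` J"] card_poly_roots_bound[of q]
      q(1) \<open>card J > n\<close> by fastforce
  then show ?thesis using q(2)[of 0] by simp
qed

text \<open>Points of the parabola x + t e + t^2 f serve, with f = \<open>cross3 x e\<close> and x,
  e, f an orthogonal basis: the determinant of three of them is the Vandermonde product of the
  parameters times \<open>f \<bullet> f\<close>. Small parameters keep the points in C.\<close>

lemma open_contains_general_position:
  fixes C :: "(real^3) set"
  assumes "open C" "C \<noteq> {}"
  obtains R :: "nat \<Rightarrow> real^3" where "\<And>i. R i \<in> C"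
    "\<And>i j k. i \<noteq> j \<Longrightarrow> i \<noteq> k \<Longrightarrow> j \<noteq> k \<Longrightarrow> R i \<bullet> cross3 (R j) (R k) \<noteq> 0"
proof -
  obtain x where x: "x \<in> C" "x \<noteq> 0"
  proof -
    have "C \<noteq> {0}" using assms not_open_singleton by metis
    then show ?thesis using assms(2) that by blast
  qed
  obtain e where e: "e \<noteq> 0" "x \<bullet> e = 0"
    using orthogonal_to_vector_exists[of x] by (auto simp: orthogonal_def)
  define f where "f = cross3 x e"
  define c where "c t = x + t *\<^sub>R e + (t^2) *\<^sub>R f" for t
  have "f \<noteq> 0"
    using dot_cross[of x e x e] x(2) e by (auto simp: f_def)
  have det: "c p \<bullet> cross3 (c q) (c s) = (q - p) * (s - p) * (s - q) * (f \<bullet> f)" for p q s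
  proof -
    have "c p \<bullet> cross3 (c q) (c s) = (q - p) * (s - p) * (s - q) * (x \<bullet> cross3 e f)"
      unfolding c_def by (simp add: cross3_def inner_vec_def sum_3) algebra
    also have "x \<bullet> cross3 e f = f \<bullet> f"
      by (simp add: f_def cross3_simps)
    finally show ?thesis .
  qed
  have "(c \<longlongrightarrow> x + 0 *\<^sub>R e + (0^2) *\<^sub>R f) (at 0)"
    unfolding c_def by (intro tendsto_intros)
  then have "\<forall>\<^sub>F t in at 0. c t \<in> C"
    using \<open>open C\<close> x(1) by (intro topological_tendstoD) auto
  then obtain d where d: "d > 0" "\<And>t. t \<noteq> 0 \<Longrightarrow> \<bar>t\<bar> < d \<Longrightarrow> c t \<in> C"
    by (auto simp: eventually_at dist_real_def)
  \<comment> \<open>The shift by 2 keeps \<open>T 0\<close> strictly below d.\<close>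
  define T where "T i = d / (real i + 2)" for i :: nat
  have T: "T i \<noteq> 0" "\<bar>T i\<bar> < d" for i
    using d(1) by (auto simp: T_def field_simps intro: add_pos_nonneg)
  have inj: "T i \<noteq> T j" if "i \<noteq> j" for i j
    using that d(1) by (auto simp: T_def field_simps)
  show ?thesis
  proof
    show "c (T i) \<in> C" for i using T d(2) by blast
    show "c (T i) \<bullet> cross3 (c (T j)) (c (T k)) \<noteq> 0" if "i \<noteq> j" "i \<noteq> k" "j \<noteq> k" for i j k
      using inj[of i j] inj[of i k] inj[of j k] that \<open>f \<noteq> 0\<close> by (simp add: det)
  qed
qed

text \<open>Pairwise intersections of \<open>n + 2\<close> lines in general position form a unisolvent set
  for plane curves of degree \<open>n\<close>, so the interpolating form has an explicit Lagrange formula.\<close>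

lemma homogeneous_polynomial_if_on_planes:
  fixes G :: "real^3 \<Rightarrow> real"
  assumes "open C" "C \<noteq> {}" "0 \<notin> C"
    and planes: "\<And>r. r \<in> C \<Longrightarrow>
      \<exists>H. homogeneous_polynomial n H \<and> (\<forall>M. M \<noteq> 0 \<longrightarrow> r \<bullet> M = 0 \<longrightarrow> G M = H M)"
  shows "\<exists>\<Psi>. homogeneous_polynomial n \<Psi> \<and> (\<forall>r\<in>C. \<forall>M. M \<noteq> 0 \<longrightarrow> r \<bullet> M = 0 \<longrightarrow> G M = \<Psi> M)"
proof -
  obtain R :: "nat \<Rightarrow> real^3" where RC: "\<And>i. R i \<in> C" and
    R: "\<And>i j k. i \<noteq> j \<Longrightarrow> i \<noteq> k \<Longrightarrow> j \<noteq> k \<Longrightarrow> R i \<bullet> cross3 (R j) (R k) \<noteq> 0"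
    using open_contains_general_position[OF assms(1,2)] by metis
  define p where "p i j = cross3 (R i) (R j)" for i j
  have p0: "p i j \<noteq> 0" if "i \<noteq> j" for i j
  proof -
    obtain k where "k \<notin> {i, j}" using ex_new_if_finite[OF infinite_UNIV_nat, of "{i, j}"] by auto
    then show ?thesis using R[of k i j] that by (auto simp: p_def)
  qed
  have Rp: "R i \<bullet> p i j = 0" "R j \<bullet> p i j = 0" for i j
    by (simp_all add: p_def dot_cross_self)
  \<comment> \<open>The Lagrange basis: \<open>L i j\<close> is the product of the linear forms of
    the n lines other than i and j, each scaled to be 1 at the node \<open>p i j\<close>. At any
    other node it vanishes, since at least one of the two lines through that node is a
    factor.\<close>
  define L where "L i j M = (\<Prod>k\<in>{..n+1}-{i,j}. ((1 / (R k \<bullet> p i j)) *\<^sub>R R k) \<bullet> M)" for i j M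
  define T where "T = {(i, j). i < j \<and> j \<le> n + 1}"
  have "finite T"
    by (rule finite_subset[of _ "{..n+1} \<times> {..n+1}"]) (auto simp: T_def)
  define \<Psi> where "\<Psi> M = (\<Sum>(i,j)\<in>T. G (p i j) * L i j M)" for M
  have hL: "homogeneous_polynomial n (L i j)" if "(i, j) \<in> T" for i j
  proof -
    have "(\<Sum>k\<in>{..n+1}-{i,j}. 1) = n"
      using that by (simp add: T_def card_Diff_subset)
    moreover have "homogeneous_polynomial (\<Sum>k\<in>{..n+1}-{i,j}. 1) (L i j)"
      unfolding L_def by (intro homogeneous_polynomial_prod homogeneous_polynomial_inner) simp
    ultimately show ?thesis by simp
  qed
  have h\<Psi>: "homogeneous_polynomial n \<Psi>"
    unfolding \<Psi>_def split_def
    by (intro homogeneous_polynomial_sum homogeneous_polynomial_cmult hL) simp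
  have \<Psi>p: "\<Psi> (p i j) = G (p i j)" if "(i, j) \<in> T" for i j
  proof -
    have "L a b (p i j) = (if (a, b) = (i, j) then 1 else 0)" if "(a, b) \<in> T" for a b
    proof (cases "(a, b) = (i, j)")
      case True
      have "R k \<bullet> p i j \<noteq> 0" if "k \<noteq> i" "k \<noteq> j" for k
        using R[of k i j] that \<open>(i, j) \<in> T\<close> by (auto simp: p_def T_def)
      then show ?thesis using True by (simp add: L_def)
    next
      case False
      then have "\<not> {i, j} \<subseteq> {a, b}"
        using that \<open>(i, j) \<in> T\<close> unfolding T_def by force
      then obtain k where "k \<in> {i, j} - {a, b}" by blast
      then have "k \<in> {..n+1} - {a, b}" "R k \<bullet> p i j = 0"
        using \<open>(i, j) \<in> T\<close> Rp by (auto simp: T_def)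
      then show ?thesis using False by (auto simp: L_def intro!: prod_zero)
    qed
    then have "\<Psi> (p i j) = (\<Sum>z\<in>T. if z = (i, j) then G (p i j) else 0)"
      unfolding \<Psi>_def by (intro sum.cong) (auto split: if_splits)
    also have "\<dots> = G (p i j)"
      using \<open>finite T\<close> that by simp
    finally show ?thesis .
  qed
  have hdiff: "homogeneous_polynomial n (\<lambda>M. H M - \<Psi> M)" if "homogeneous_polynomial n H" for H
    using homogeneous_polynomial_add[OF that homogeneous_polynomial_cmult[OF h\<Psi>, of "-1"]] by simp
  \<comment> \<open>On the line with normal \<open>R i\<close>, the local form H and \<Psi> agree at
    n + 1 nodes, one more than two different forms of degree n can share.\<close>
  have on_R: "G M = \<Psi> M" if i: "i \<le> n + 1" and M: "M \<noteq> 0" "R i \<bullet> M = 0" for i M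
  proof -
    obtain H where H: "homogeneous_polynomial n H"
      "\<And>M. M \<noteq> 0 \<Longrightarrow> R i \<bullet> M = 0 \<Longrightarrow> G M = H M"
      using planes[OF RC[of i]] by blast
    have "H M - \<Psi> M = 0"
    proof (rule homogeneous_polynomial_zero_on_plane[OF hdiff[OF H(1)]])
      show "finite ({..n+1} - {i})" "n < card ({..n+1} - {i})" using i by auto
      show "R i \<noteq> 0" using R[of i "i+1" "i+2"] by auto
      show "R i \<bullet> M = 0" "M \<noteq> 0" by fact+
    next
      fix j assume j: "j \<in> {..n+1} - {i}"
      have "H (p i j) = \<Psi> (p i j)"
      proof (cases "i < j")
        case True
        then show ?thesis using j H(2)[OF p0 Rp(1)] \<Psi>p[of i j] by (auto simp: T_def)
      next
        case False
        \<comment> \<open>The values of \<Psi> were prescribed at the nodes with i < j only;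
          reversing the order changes both forms by the same factor.\<close>
        have "p i j = (-1) *\<^sub>R p j i" by (simp add: p_def cross_skew[of "R i"])
        moreover have "H (p j i) = \<Psi> (p j i)"
          using False j i H(2)[OF p0 Rp(2)] \<Psi>p[of j i] by (auto simp: T_def)
        ultimately show ?thesis
          by (simp only: homogeneous_polynomial_scaleR[OF H(1)] homogeneous_polynomial_scaleR[OF h\<Psi>])
      qed
      then show "p i j \<noteq> 0 \<and> R i \<bullet> p i j = 0 \<and> H (p i j) - \<Psi> (p i j) = 0"
        using p0 Rp j by auto
    next
      fix j k assume "j \<in> {..n+1} - {i}" "k \<in> {..n+1} - {i}" "j \<noteq> k"
      then show "cross3 (p i j) (p i k) \<noteq> 0"
        using R[of i j k] R[of i "i+1" "i+2"] by (auto simp: p_def cross3_cross3_common)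
    qed
    then show ?thesis using H(2)[OF M] by simp
  qed
  have "G M = \<Psi> M" if r: "r \<in> C" and M: "M \<noteq> 0" "r \<bullet> M = 0" for r M
  proof (cases "\<exists>i\<le>n+1. R i \<bullet> M = 0")
    case True
    then show ?thesis using on_R M by blast
  next
    case False
    have "r \<noteq> 0" using r assms(3) by blast
    \<comment> \<open>The line of r may pass through nodes and so meet the n + 2 chosen lines in too
      few points. Moving r slightly in the direction u keeps it in C and orthogonal to M; B contains
      the parameters at which a node with \<open>u \<bullet> p i j\<close> nonzero is hit.\<close>
    define u where "u = cross3 r M"
    define B where "B = (\<lambda>(i,j). - (r \<bullet> p i j) / (u \<bullet> p i j)) ` ({..n+1} \<times> {..n+1})"
    have "((\<lambda>t. r + t *\<^sub>R u) \<longlongrightarrow> r + 0 *\<^sub>R u) (at 0)"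
      by (intro tendsto_intros)
    then have "\<forall>\<^sub>F t in at 0. r + t *\<^sub>R u \<in> C"
      using \<open>open C\<close> r by (intro topological_tendstoD) auto
    then obtain d where d: "d > 0" "\<And>t. t \<noteq> 0 \<Longrightarrow> \<bar>t\<bar> < d \<Longrightarrow> r + t *\<^sub>R u \<in> C"
      by (auto simp: eventually_at dist_real_def)
    have "finite B" by (auto simp: B_def)
    then obtain t where t: "t \<in> {0<..<d}" "t \<notin> B"
      using d(1) by (meson finite_subset infinite_Ioo subsetI)
    define r' where "r' = r + t *\<^sub>R u"
    have "r' \<in> C" using t d(2) by (auto simp: r'_def)
    have "r' \<bullet> M = 0"
      by (simp add: r'_def u_def inner_add_left M(2) dot_cross_self)
    have r'p: "r' \<bullet> p i j \<noteq> 0" if "i \<noteq> j" "i \<le> n+1" "j \<le> n+1" for i j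
    proof
      assume 0: "r' \<bullet> p i j = 0"
      show False
      proof (cases "u \<bullet> p i j = 0")
        \<comment> \<open>A node orthogonal to both r and u is a multiple of M, so M would lie on
          one of the chosen lines.\<close>
        case True
        then have "r \<bullet> p i j = 0" using 0 by (simp add: r'_def inner_add_left)
        then have eq: "(u \<bullet> u) *\<^sub>R p i j = ((p i j \<bullet> M) * (r \<bullet> r)) *\<^sub>R M"
          using orthogonal_plane_expansion[OF M(2), of "p i j"] True
          by (simp add: u_def inner_commute)
        moreover have "u \<bullet> u \<noteq> 0"
          using dot_cross[of r M r M] M \<open>r \<noteq> 0\<close> by (auto simp: u_def)
        ultimately have "(p i j \<bullet> M) * (r \<bullet> r) \<noteq> 0"
          using p0[OF that(1)] by auto
        moreover have "((p i j \<bullet> M) * (r \<bullet> r)) * (R i \<bullet> M) = 0"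
          using arg_cong[OF eq, of "\<lambda>v. R i \<bullet> v"] Rp(1) by simp
        ultimately have "R i \<bullet> M = 0" by simp
        then show False using \<open>\<not> (\<exists>i\<le>n+1. R i \<bullet> M = 0)\<close> that by blast
      next
        case False
        then have "t = - (r \<bullet> p i j) / (u \<bullet> p i j)"
          using 0 by (simp add: r'_def inner_add_left field_simps eq_neg_iff_add_eq_0 add.commute)
        then show False using t(2) that by (auto simp: B_def)
      qed
    qed
    have "r' \<noteq> 0" using assms(3) \<open>r' \<in> C\<close> by blast
    obtain H where H: "homogeneous_polynomial n H"
      "\<And>M. M \<noteq> 0 \<Longrightarrow> r' \<bullet> M = 0 \<Longrightarrow> G M = H M"
      using planes[OF \<open>r' \<in> C\<close>] by blast
    have ind: "cross3 (cross3 r' (R j)) (cross3 r' (R k)) \<noteq> 0"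
      if "j \<in> {..n+1}" "k \<in> {..n+1}" "j \<noteq> k" for j k
      using r'p[of j k] \<open>r' \<noteq> 0\<close> that by (auto simp: p_def cross3_cross3_common)
    \<comment> \<open>The line of r' meets the chosen lines in n + 2 distinct points; there H equals
      G, and G equals \<Psi> by \<open>on_R\<close>.\<close>
    have "H M - \<Psi> M = 0"
    proof (rule homogeneous_polynomial_zero_on_plane[OF hdiff[OF H(1)] _ _ \<open>r' \<noteq> 0\<close> _ ind])
      fix j assume j: "j \<in> {..n+1}"
      obtain k where "k \<in> {..n+1}" "j \<noteq> k"
        using that[of 0] that[of 1] by (cases "j = 0") auto
      then have 0: "cross3 r' (R j) \<noteq> 0"
        using ind[OF j] by (metis cross_zero_left)
      have perp: "r' \<bullet> cross3 r' (R j) = 0" "R j \<bullet> cross3 r' (R j) = 0"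
        by (simp_all add: dot_cross_self)
      have "H (cross3 r' (R j)) = \<Psi> (cross3 r' (R j))"
        using H(2)[OF 0 perp(1)] on_R[OF _ 0 perp(2)] j by simp
      then show "cross3 r' (R j) \<noteq> 0 \<and> r' \<bullet> cross3 r' (R j) = 0 \<and>
          H (cross3 r' (R j)) - \<Psi> (cross3 r' (R j)) = 0"
        using 0 perp by simp
    qed (use M \<open>r' \<bullet> M = 0\<close> in auto)
    then show ?thesis using H(2) M \<open>r' \<bullet> M = 0\<close> by simp
  qed
  then show ?thesis using h\<Psi> by blast
qed

section \<open>Geodesics\<close>

lemma form_commute: "form K x y = form K y x"
  by (simp add: form_def mult.commute)

lemma form_bilinear [simp]:
  "form K (x + y) z = form K x z + form K y z"
  "form K (x - y) z = form K x z - form K y z"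
  "form K (- x) z = - form K x z"
  "form K (c *\<^sub>R x) z = c * form K x z"
  "form K z (x + y) = form K z x + form K z y"
  "form K z (x - y) = form K z x - form K z y"
  "form K z (- x) = - form K z x"
  "form K z (c *\<^sub>R x) = c * form K z x"
  by (simp_all add: form_def algebra_simps)

text \<open>Lowers an index with \<open>form K\<close>, which turns its values into Euclidean inner
  products and makes the identities for \<open>cross3\<close> applicable.\<close>

definition lower :: "real \<Rightarrow> real^3 \<Rightarrow> real^3" where
  "lower K x = (\<chi> i. if i = 3 then K * x $ 3 else x $ i)"

lemma form_eq_inner_lower: "form K x y = x \<bullet> lower K y"
  by (simp add: form_def lower_def inner_vec_def sum_3 algebra_simps)

lemma zero_cross_imp_parallel: "cross3 a b = 0 \<Longrightarrow> (a \<bullet> a) *\<^sub>R b = (a \<bullet> b) *\<^sub>R a"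
  using Lagrange[of a a b] by simp

lemma Cauchy_Schwarz_2: "(a * c + b * d)^2 \<le> (a^2 + b^2) * (c^2 + d^2)" for a b c d :: real
proof -
  have "(a^2 + b^2) * (c^2 + d^2) - (a * c + b * d)^2 = (a * d - b * c)^2"
    by (simp add: power2_eq_square algebra_simps)
  then show ?thesis by (metis diff_ge_0_iff_ge zero_le_power2)
qed

text \<open>\<open>cosK\<close> and \<open>sinK\<close> are the solutions of f'' = - K f with
  initial values (1, 0) and (0, 1), so spherical and hyperbolic geodesics get the same
  formula.\<close>

definition cosK :: "real \<Rightarrow> real \<Rightarrow> real" where
  "cosK K t = (if K = 1 then cos t else cosh t)"

definition sinK :: "real \<Rightarrow> real \<Rightarrow> real" where
  "sinK K t = (if K = 1 then sin t else sinh t)"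

definition geo :: "real \<Rightarrow> real^3 \<Rightarrow> real^3 \<Rightarrow> real \<Rightarrow> real^3" where
  "geo K r v t = cosK K t *\<^sub>R r + sinK K t *\<^sub>R v"

definition geo_velocity :: "real \<Rightarrow> real^3 \<Rightarrow> real^3 \<Rightarrow> real \<Rightarrow> real^3" where
  "geo_velocity K r v t = (- K * sinK K t) *\<^sub>R r + cosK K t *\<^sub>R v"

lemma cosK_sinK_0 [simp]: "cosK K 0 = 1" "sinK K 0 = 0"
  by (simp_all add: cosK_def sinK_def)

lemma geo_0 [simp]: "geo K r v 0 = r" "geo_velocity K r v 0 = v"
  by (simp_all add: geo_def geo_velocity_def)

lemma geo_uminus: "geo K r (- v) (- t) = geo K r v t"
  by (simp add: geo_def cosK_def sinK_def)

context
  fixes K :: real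
  assumes K: "K \<in> {1, -1}"
begin

lemma K_square: "K * K = 1"
  using K by auto

text \<open>Binet-Cauchy identity for \<open>form K\<close>; the factor K is the determinant of its
  matrix. By it the momentum of a unit tangent vector is again of norm 1.\<close>

lemma form_cross: "form K (cross3 a b) (cross3 c d) = K * (form K a c * form K b d - form K a d * form K b c)"
  using K by (auto simp: form_def cross3_def algebra_simps)

lemma has_derivative_cosK: "(cosK K has_real_derivative - K * sinK K t) (at t within A)"
  and has_derivative_sinK: "(sinK K has_real_derivative cosK K t) (at t within A)"
  using K by (auto simp: cosK_def[abs_def] sinK_def[abs_def] intro!: derivative_eq_intros)

lemma cosK_sinK: "cosK K t * cosK K t + K * (sinK K t * sinK K t) = 1"
proof (cases "K = 1")
  case True
  then show ?thesis using sin_cos_squared_add3[of t] by (simp add: cosK_def sinK_def)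
next
  case False
  then show ?thesis using K cosh_square_eq[of t] by (simp add: cosK_def sinK_def power2_eq_square)
qed

lemma sinK_diff: "sinK K (s - t) = sinK K s * cosK K t - cosK K s * sinK K t"
  using K by (auto simp: sinK_def cosK_def sin_diff sinh_diff)

lemma sinK_pos: "0 < t \<Longrightarrow> (K = 1 \<longrightarrow> t < pi) \<Longrightarrow> 0 < sinK K t"
  using K by (auto simp: sinK_def intro: sin_gt_zero)

lemma has_vector_derivative_scaleR_const:
  assumes "(f has_real_derivative d) (at t within A)"
  shows "((\<lambda>x. f x *\<^sub>R c) has_vector_derivative d *\<^sub>R c) (at t within A)"
  using has_vector_derivative_scaleR[OF assms has_vector_derivative_const] by simp

lemma geo_has_derivative:
  "(geo K r v has_vector_derivative geo_velocity K r v t) (at t within A)"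
  unfolding geo_def[abs_def] geo_velocity_def
  by (intro has_vector_derivative_add has_vector_derivative_scaleR_const
      has_derivative_cosK has_derivative_sinK)

lemma geo_velocity_has_derivative:
  "(geo_velocity K r v has_vector_derivative (- K) *\<^sub>R geo K r v t) (at t within A)"
proof -
  have "(geo_velocity K r v has_vector_derivative
      (- K * cosK K t) *\<^sub>R r + (- K * sinK K t) *\<^sub>R v) (at t within A)"
    unfolding geo_velocity_def[abs_def]
    by (intro has_vector_derivative_add has_vector_derivative_scaleR_const
        has_derivative_cosK has_derivative_sinK DERIV_cmult)
  then show ?thesis by (simp add: geo_def scaleR_add_right)
qed

lemma geo_continuous: "continuous_on A (geo K r v)"
  unfolding continuous_on_eq_continuous_within
  using has_vector_derivative_continuous[OF geo_has_derivative] by blast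

text \<open>Position and velocity evolve inside the plane of r and v by a matrix of determinant
  1.\<close>

lemma cross_geo: "cross3 (geo K r v t) (geo_velocity K r v t) = cross3 r v"
proof -
  have "cross3 (geo K r v t) (geo_velocity K r v t)
    = (cosK K t * cosK K t + K * (sinK K t * sinK K t)) *\<^sub>R cross3 r v"
    using cross_skew[of v r]
    by (simp add: geo_def geo_velocity_def cross_add_left cross_add_right cross_mult_left
        cross_mult_right Cross3.right_diff_distrib algebra_simps)
  then show ?thesis by (simp add: cosK_sinK)
qed

lemma surfaceD: "x \<in> surface K \<Longrightarrow> form K x x = K"
  by (simp add: surface_def)

text \<open>For K = -1 the tangent planes of the hyperboloid are spacelike: by Cauchy-Schwarz in the
  first two coordinates, a tangent vector with nonpositive form has third coordinate 0, hence is
  0.\<close>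

lemma tangent_form_pos:
  assumes r: "r \<in> surface K" and v: "form K r v = 0" "v \<noteq> 0"
  shows "form K v v > 0"
proof (cases "K = 1")
  case True
  then have "form K v v = v \<bullet> v" by (simp add: form_def inner_vec_def sum_3)
  then show ?thesis using v(2) by simp
next
  case False
  then have [simp]: "K = -1" using K by simp
  have r: "r$1^2 + r$2^2 = r$3^2 - 1" and v1: "r$1 * v$1 + r$2 * v$2 = r$3 * v$3"
    using surfaceD[OF r] v(1) by (auto simp: form_def power2_eq_square)
  have "(r$3 * v$3)^2 \<le> (r$3^2 - 1) * (v$1^2 + v$2^2)"
    unfolding v1[symmetric] r[symmetric] by (rule Cauchy_Schwarz_2)
  also have "(r$3^2 - 1) * (v$1^2 + v$2^2) \<le> (r$3^2 - 1) * v$3^2" if "v$1^2 + v$2^2 \<le> v$3^2"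
    using that unfolding r[symmetric] by (intro mult_left_mono) auto
  finally have "v$3^2 \<le> 0" if "v$1^2 + v$2^2 \<le> v$3^2"
    using that by (simp add: power_mult_distrib algebra_simps)
  then have "v = 0" if "v$1^2 + v$2^2 \<le> v$3^2"
    using that by (auto simp: vec_eq_iff forall_3 sum_power2_le_zero_iff)
  then show ?thesis using v(2) by (fastforce simp: form_def power2_eq_square)
qed

lemma surface_form_neg:
  assumes "K = -1" and r: "r \<in> surface K" and q: "q \<in> surface K"
  shows "form K r q < 0"
proof -
  have r: "r$1^2 + r$2^2 = r$3^2 - 1" "r$3 > 0" and q: "q$1^2 + q$2^2 = q$3^2 - 1" "q$3 > 0"
    using r q \<open>K = -1\<close> by (auto simp: surface_def form_def power2_eq_square)
  have pos: "r$3^2 - 1 \<ge> 0" "q$3^2 - 1 \<ge> 0"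
    unfolding r(1)[symmetric] q(1)[symmetric] by auto
  have "(r$1 * q$1 + r$2 * q$2)^2 \<le> (r$3^2 - 1) * (q$3^2 - 1)"
    unfolding r(1)[symmetric] q(1)[symmetric] by (rule Cauchy_Schwarz_2)
  also have "\<dots> < (r$3 * q$3)^2"
    using pos by (simp add: algebra_simps power_mult_distrib)
  finally have "r$1 * q$1 + r$2 * q$2 < r$3 * q$3"
    by (rule power2_less_imp_less) (simp add: less_imp_le r(2) q(2))
  then show ?thesis using \<open>K = -1\<close> by (simp add: form_def)
qed

lemma surface_scaleR_cases:
  assumes "r \<in> surface K" "c *\<^sub>R r \<in> surface K"
  shows "c = 1 \<or> (K = 1 \<and> c = -1)"
proof -
  have "c * (c * K) = K" using surfaceD[OF assms(1)] surfaceD[OF assms(2)] by simp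
  then have "c = 1 \<or> c = -1" using K by (auto simp: square_eq_1_iff)
  moreover have "c \<noteq> -1" if "K = -1" using assms that by (auto simp: surface_def)
  ultimately show ?thesis using K by auto
qed

lemma geo_surface:
  assumes r: "r \<in> surface K" and v: "form K r v = 0" "form K v v = 1"
  shows "geo K r v t \<in> surface K"
proof -
  have "form K (geo K r v t) (geo K r v t)
      = cosK K t * cosK K t * form K r r + sinK K t * sinK K t"
    using v form_commute[of K v r] by (simp add: geo_def algebra_simps)
  also have "\<dots> = K * (cosK K t * cosK K t + K * (sinK K t * sinK K t))"
    using K surfaceD[OF r] by (auto simp: algebra_simps)
  finally have "form K (geo K r v t) (geo K r v t) = K" by (simp add: cosK_sinK)
  \<comment> \<open>The quadratic equation does not separate the two sheets. The upper one is kept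
    because |v$3| < r$3 and |sinh t| < cosh t.\<close>
  moreover have "geo K r v t $ 3 > 0" if "K = -1"
  proof -
    have r: "r$1^2 + r$2^2 = r$3^2 - 1" "r$3 > 0" and v1: "r$1 * v$1 + r$2 * v$2 = r$3 * v$3"
      and v2: "v$1^2 + v$2^2 = 1 + v$3^2"
      using r v \<open>K = -1\<close> by (auto simp: surface_def form_def power2_eq_square)
    have "(r$3 * v$3)^2 \<le> (r$3^2 - 1) * (1 + v$3^2)"
      unfolding v1[symmetric] r(1)[symmetric] v2[symmetric] by (rule Cauchy_Schwarz_2)
    then have "\<bar>v$3\<bar>^2 < (r$3)^2" by (simp add: algebra_simps power_mult_distrib)
    then have "\<bar>v$3\<bar> < r$3" by (rule power2_less_imp_less) (simp add: less_imp_le r(2))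
    moreover have "\<bar>sinh t\<bar> < cosh t"
      using sinh_less_cosh_real[of t] sinh_less_cosh_real[of "-t"] by (simp add: abs_if)
    ultimately have "\<bar>sinh t\<bar> * \<bar>v$3\<bar> < cosh t * r$3"
      by (intro mult_strict_mono') auto
    then show ?thesis using that by (simp add: geo_def cosK_def sinK_def abs_mult[symmetric])
  qed
  ultimately show ?thesis by (simp add: surface_def)
qed

lemma form_geo_velocity:
  assumes r: "r \<in> surface K" and v: "form K r v = 0" "form K v v = 1"
  shows "form K (geo_velocity K r v t) (geo_velocity K r v t) = 1"
    and "form K (geo K r v t) (geo_velocity K r v t) = 0"
proof -
  have "form K (geo_velocity K r v t) (geo_velocity K r v t)
      = (K * K) * (K * (sinK K t * sinK K t)) + cosK K t * cosK K t"
    using v form_commute[of K v r] surfaceD[OF r] by (simp add: geo_velocity_def algebra_simps)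
  then show "form K (geo_velocity K r v t) (geo_velocity K r v t) = 1"
    using cosK_sinK[of t] by (simp add: K_square)
  have "form K (geo K r v t) (geo_velocity K r v t) = (1 - K * K) * (sinK K t * cosK K t)"
    using v form_commute[of K v r] surfaceD[OF r]
    by (simp add: geo_def geo_velocity_def algebra_simps)
  then show "form K (geo K r v t) (geo_velocity K r v t) = 0" by (simp add: K_square)
qed

lemma geodesic_on_geo:
  assumes "r \<in> surface K" "form K r v = 0" "form K v v = 1"
  shows "geodesic_on K A (geo K r v)"
  unfolding geodesic_on_def
proof (intro conjI exI[of _ "geo_velocity K r v"] ballI)
  show "geo K r v ` A \<subseteq> surface K" using geo_surface[OF assms] by blast
qed (rule geo_has_derivative form_geo_velocity(1)[OF assms] exI geo_velocity_has_derivative)+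

text \<open>The momentum map from the tangent plane at r to the plane orthogonal to r is inverted by
  sending M to \<open>K *\<^sub>R cross3 M (lower K r)\<close>. Thus position and momentum determine
  the velocity.\<close>

lemma tangent_from_cross:
  assumes "r \<in> surface K" "form K r v = 0"
  shows "v = K *\<^sub>R cross3 (cross3 r v) (lower K r)"
proof -
  have "cross3 (lower K r) (cross3 r v) = - (K *\<^sub>R v)"
    using assms(2) form_commute[of K v r] surfaceD[OF assms(1)]
    by (simp add: Lagrange form_eq_inner_lower inner_commute)
  then have "cross3 (cross3 r v) (lower K r) = K *\<^sub>R v"
    using cross_skew[of "cross3 r v" "lower K r"] by simp
  then show ?thesis by (simp add: K_square)
qed

lemma tangent_of_normal:
  assumes "r \<in> surface K" "r \<bullet> M = 0"
  shows "form K r (K *\<^sub>R cross3 M (lower K r)) = 0"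
    and "cross3 r (K *\<^sub>R cross3 M (lower K r)) = M"
proof -
  show "form K r (K *\<^sub>R cross3 M (lower K r)) = 0"
    by (subst form_commute) (simp add: form_eq_inner_lower dot_cross_self)
  have "r \<bullet> lower K r = K" using surfaceD[OF assms(1)] by (simp add: form_eq_inner_lower)
  then show "cross3 r (K *\<^sub>R cross3 M (lower K r)) = M"
    using assms(2) by (simp add: cross_mult_right Lagrange K_square)
qed

text \<open>The direction v is the normalized tangential part of q at r, and t is the distance: f is
  cos t on the sphere and - cosh t on the hyperboloid, and \<open>sqrt d\<close> is sin t or sinh
  t.\<close>

lemma geo_connect:
  assumes r: "r \<in> surface K" and q: "q \<in> surface K" and "q \<noteq> r" and "K = 1 \<longrightarrow> q \<noteq> - r"
  obtains v t where "form K r v = 0" "form K v v = 1" "0 < t" "K = 1 \<longrightarrow> t < pi" "geo K r v t = q"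
proof -
  define f where "f = form K r q"
  define u where "u = q - (K * f) *\<^sub>R r"
  define d where "d = form K u u"
  define v where "v = (1 / sqrt d) *\<^sub>R u"
  have ru: "form K r u = 0"
    using K surfaceD[OF r] by (auto simp: u_def f_def)
  have "u \<noteq> 0"
    using surface_scaleR_cases[OF r, of "K * f"] assms(2-4) by (auto simp: u_def)
  then have d: "d > 0" unfolding d_def by (rule tangent_form_pos[OF r ru])
  have du: "d = K - K * f^2"
    using K surfaceD[OF r] surfaceD[OF q] form_commute[of K q r]
    by (auto simp: d_def u_def f_def power2_eq_square algebra_simps)
  have v: "form K r v = 0" "form K v v = 1"
    using d by (simp_all add: v_def ru d_def[symmetric])
  have qv: "q = (K * f) *\<^sub>R r + sqrt d *\<^sub>R v"
    using d by (simp add: v_def u_def)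
  show ?thesis
  proof (cases "K = 1")
    case True
    then have "f^2 < 1" using d du by simp
    then have "\<bar>f\<bar> < 1" by (simp add: abs_square_less_1)
    then have f: "- 1 < f" "f < 1" by auto
    show ?thesis
    proof (rule that[OF v, of "arccos f"])
      show "0 < arccos f" "K = 1 \<longrightarrow> arccos f < pi" using arccos_lt_bounded[OF f] by auto
      show "geo K r v (arccos f) = q"
        using True f du by (simp add: qv geo_def cosK_def sinK_def sin_arccos)
    qed
  next
    case False
    then have "K = -1" using K by simp
    then have "f < 0" using surface_form_neg r q by (simp add: f_def)
    show ?thesis
    proof (rule that[OF v, of "arsinh (sqrt d)"])
      have "sinh (arsinh (sqrt d)) > 0" using d by simp
      then show "0 < arsinh (sqrt d)" by (simp only: sinh_real_pos_iff)
      show "K = 1 \<longrightarrow> arsinh (sqrt d) < pi" using False by simp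
      have "cosh (arsinh (sqrt d)) = - f"
        using \<open>f < 0\<close> du d \<open>K = -1\<close> by (simp add: cosh_arsinh_real)
      then show "geo K r v (arsinh (sqrt d)) = q"
        using \<open>K = -1\<close> by (simp add: qv geo_def cosK_def sinK_def)
    qed
  qed
qed

text \<open>By the addition formula, the point at parameter x is proportional to sin(t - x) r +
  sin(x) q, where q is the end of the segment and sin stands for \<open>sinK K\<close>. The
  intermediate value theorem gives an x for which these weights are in the ratio a : b.\<close>

lemma positive_combination_on_geo:
  assumes t: "0 < t" "K = 1 \<longrightarrow> t < pi" and ab: "a > 0" "b > 0"
  obtains x c where "x \<in> {0..t}" "c > 0" "a *\<^sub>R r + b *\<^sub>R geo K r v t = c *\<^sub>R geo K r v x"
proof -
  have s: "sinK K t > 0" using sinK_pos t by blast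
  have "continuous_on {0..t} (\<lambda>x. sinK K (t - x) * b - sinK K x * a)"
    using K by (auto simp: sinK_def intro!: continuous_intros)
  then obtain x where x: "0 \<le> x" "x \<le> t" "sinK K (t - x) * b = sinK K x * a"
    using IVT2'[of "\<lambda>x. sinK K (t - x) * b - sinK K x * a" t 0 0] s ab t by auto
  define m where "m = sinK K (t - x) + sinK K x"
  have pos: "sinK K y \<ge> 0" if "0 \<le> y" "y \<le> t" for y
    using sinK_pos[of y] that t by (cases "y = 0") auto
  have "m > 0"
  proof (cases "x = 0")
    case False
    then have "sinK K x > 0" using sinK_pos[of x] x t by auto
    then show ?thesis using pos[of "t - x"] x by (simp add: m_def)
  qed (simp add: m_def s)
  have "(a + b) * sinK K (t - x) = a * m" "(a + b) * sinK K x = b * m"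
    using x(3) by (simp_all add: m_def algebra_simps)
  moreover have "sinK K t *\<^sub>R geo K r v x = sinK K (t - x) *\<^sub>R r + sinK K x *\<^sub>R geo K r v t"
    by (simp add: geo_def sinK_diff algebra_simps)
  then have "((a + b) * sinK K t) *\<^sub>R geo K r v x
      = ((a + b) * sinK K (t - x)) *\<^sub>R r + ((a + b) * sinK K x) *\<^sub>R geo K r v t"
    by (simp add: scaleR_add_right flip: scaleR_scaleR)
  ultimately have "((a + b) * sinK K t) *\<^sub>R geo K r v x = m *\<^sub>R (a *\<^sub>R r + b *\<^sub>R geo K r v t)"
    by (simp add: algebra_simps)
  then have "(1 / m) *\<^sub>R ((a + b) * sinK K t) *\<^sub>R geo K r v x = a *\<^sub>R r + b *\<^sub>R geo K r v t"
    using \<open>m > 0\<close> by simp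
  then show ?thesis
    using that[of x "(a + b) * sinK K t / m"] x \<open>m > 0\<close> s ab by simp
qed

end

section \<open>Billiards in a convex domain\<close>

text \<open>Replaces \<Omega> by a Euclidean open convex set, so that separation by planes is
  available at the boundary for both signs of K.\<close>

definition cone_over :: "(real^3) set \<Rightarrow> (real^3) set" where
  "cone_over \<Omega> = {c *\<^sub>R x |c x. c > 0 \<and> x \<in> \<Omega>}"

definition even_part :: "(real^3 \<Rightarrow> real^3 \<Rightarrow> real) \<Rightarrow> real^3 \<Rightarrow> real^3 \<Rightarrow> real" where
  "even_part \<Phi> r v = (\<Phi> r v + \<Phi> r (- v)) / 2"

lemma even_part_uminus [simp]: "even_part \<Phi> r (- v) = even_part \<Phi> r v"
  by (simp add: even_part_def)

lemma geo_reverse: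
  assumes "K \<in> {1, -1}"
  shows "geo K (geo K r v t) (- geo_velocity K r v t) x = geo K r v (t - x)"
    and "geo_velocity K (geo K r v t) (- geo_velocity K r v t) x = - geo_velocity K r v (t - x)"
proof -
  have "cosK K (t - x) = cosK K t * cosK K x + K * (sinK K t * sinK K x)"
    using assms by (auto simp: sinK_def cosK_def cos_diff cosh_diff)
  then show "geo K (geo K r v t) (- geo_velocity K r v t) x = geo K r v (t - x)"
    "geo_velocity K (geo K r v t) (- geo_velocity K r v t) x = - geo_velocity K r v (t - x)"
    by (simp_all add: geo_def geo_velocity_def sinK_diff[OF assms] algebra_simps)
qed

text \<open>Derivatives in \<open>geodesic_on\<close> are taken within the parameter set, so only
  values on it matter. An orbit glued from two geodesics at a reflection can therefore be checked
  piece by piece.\<close>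

lemma geodesic_on_cong:
  assumes "\<And>t. t \<in> A \<Longrightarrow> c t = d t"
  shows "geodesic_on K A c = geodesic_on K A d"
proof -
  have *: "geodesic_on K A g" if f: "geodesic_on K A f" and eq: "\<And>t. t \<in> A \<Longrightarrow> g t = f t" for f g
  proof -
    have "(g has_vector_derivative u) (at t within A)"
      if "(f has_vector_derivative u) (at t within A)" "t \<in> A" for u t
      using has_vector_derivative_transform[OF that(2) _ that(1)] eq by blast
    moreover have "g ` A = f ` A" using eq by (rule image_cong[OF refl])
    moreover obtain u where "f ` A \<subseteq> surface K"
      "\<forall>t\<in>A. (f has_vector_derivative u t) (at t within A) \<and> form K (u t) (u t) = 1 \<and>
        (\<exists>l. (u has_vector_derivative l *\<^sub>R f t) (at t within A))"
      using f unfolding geodesic_on_def by blast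
    ultimately show ?thesis using eq unfolding geodesic_on_def
      by (intro conjI exI[of _ u]) simp_all
  qed
  show ?thesis using *[of c d] *[of d c] assms by auto
qed

lemma boundary_disjoint:
  assumes "openin (top_of_set (surface K)) \<Omega>" "x \<in> boundary K \<Omega>"
  shows "x \<notin> \<Omega>"
  using assms by (simp add: boundary_def frontier_of_def interior_of_openin)

lemma boundary_subset_surface: "boundary K \<Omega> \<subseteq> surface K"
  using frontier_of_subset_topspace[of "top_of_set (surface K)" \<Omega>] by (simp add: boundary_def)

lemma boundary_subset_closure: "boundary K \<Omega> \<subseteq> closure \<Omega>"
  by (auto simp: boundary_def frontier_of_def closure_of_subtopology intro: subsetD[OF closure_mono])

lemma subset_cone_over: "\<Omega> \<subseteq> cone_over \<Omega>"
  unfolding cone_over_def by (force intro: exI[of _ 1])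

lemma cone_over_scaleR:
  assumes "x \<in> cone_over \<Omega>" "c > 0"
  shows "c *\<^sub>R x \<in> cone_over \<Omega>"
proof -
  obtain d y where "x = d *\<^sub>R y" "d > 0" "y \<in> \<Omega>" using assms(1) by (auto simp: cone_over_def)
  then show ?thesis using assms(2) unfolding cone_over_def
    by (intro CollectI exI[of _ "c * d"] exI[of _ y]) simp
qed

section \<open>Openness and convexity of the cone over the domain\<close>

context
  fixes K :: real and \<Omega> :: "(real^3) set" and \<Gamma>\<^sub>0 :: "real^3"
  assumes K: "K \<in> {1, -1}"
    and open_domain: "openin (top_of_set (surface K)) \<Omega>"
    and convex: "geodesically_convex K \<Omega>"
    and hemisphere: "\<forall>x\<in>\<Omega>. \<Gamma>\<^sub>0 \<bullet> x > 0"
begin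

lemma domain_subset_surface: "\<Omega> \<subseteq> surface K"
  using openin_imp_subset[OF open_domain] .

text \<open>\<open>\<Gamma>\<^sub>0\<close> will be the dual vector at one point of the arc. Without
  antipodal pairs, any two distinct points of a spherical domain are joined by a geodesic shorter
  than pi, to which convexity applies.\<close>

lemma domain_not_antipodal: "x \<in> \<Omega> \<Longrightarrow> - x \<notin> \<Omega>"
  using bspec[OF hemisphere, of x] bspec[OF hemisphere, of "- x"] by auto

lemma cone_over_hemisphere: "x \<in> cone_over \<Omega> \<Longrightarrow> \<Gamma>\<^sub>0 \<bullet> x > 0"
  using hemisphere by (auto simp: cone_over_def)

lemma zero_notin_cone_over: "0 \<notin> cone_over \<Omega>"
  using cone_over_hemisphere[of 0] by auto

lemma cone_over_Int_surface:
  assumes "x \<in> cone_over \<Omega>" "x \<in> surface K"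
  shows "x \<in> \<Omega>"
proof -
  obtain c y where x: "x = c *\<^sub>R y" "c > 0" "y \<in> \<Omega>" using assms(1) by (auto simp: cone_over_def)
  then have "c = 1"
    using surface_scaleR_cases[OF K, where r = y and c = c] domain_subset_surface assms(2) by auto
  then show ?thesis using x by simp
qed

text \<open>The cone is the preimage, under the radial projection N, of an open set T that cuts
  \<Omega> out of the surface. For K = -1 the domain D of N is the inside of the upper light
  cone.\<close>

lemma open_cone_over: "open (cone_over \<Omega>)"
proof -
  obtain T where T: "open T" "\<Omega> = surface K \<inter> T"
    using open_domain by (auto simp: openin_open)
  define D where "D = {x. 0 < K * form K x x} \<inter> (if K = 1 then UNIV else {x. 0 < x $ 3})"
  define N where "N x = (1 / sqrt (K * form K x x)) *\<^sub>R x" for x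
  have cf: "continuous_on A (\<lambda>x. K * form K x x)" for A
    unfolding form_def by (intro continuous_intros)
  have "open {x::real^3. 0 < x $ 3}"
    by (intro open_Collect_less continuous_intros)
  then have "open D" unfolding D_def
    by (intro open_Int open_Collect_less cf continuous_intros) auto
  have "continuous_on D N"
    unfolding N_def by (intro continuous_intros cf) (auto simp: D_def)
  then have "open (D \<inter> N -` T)"
    using \<open>open D\<close> T(1) by (rule continuous_open_preimage)
  also have "D \<inter> N -` T = cone_over \<Omega>"
  proof (intro set_eqI iffI)
    fix x assume x: "x \<in> D \<inter> N -` T"
    define c where "c = sqrt (K * form K x x)"
    have c: "c > 0" "c * c = K * form K x x" using x by (auto simp: c_def D_def)
    have "form K x x = K * (c * c)" using K c(2) by auto
    moreover have "N x = (1 / c) *\<^sub>R x" by (simp add: N_def c_def)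
    ultimately have "form K (N x) (N x) = K" using c(1) by simp
    moreover have "K = -1 \<longrightarrow> N x $ 3 > 0"
      using x c(1) by (auto simp: N_def c_def[symmetric] D_def)
    ultimately have "N x \<in> \<Omega>" using x T(2) by (auto simp: surface_def)
    moreover have "x = c *\<^sub>R N x" using c(1) by (simp add: N_def c_def[symmetric])
    ultimately show "x \<in> cone_over \<Omega>" using c(1) unfolding cone_over_def by blast
  next
    fix x assume "x \<in> cone_over \<Omega>"
    then obtain c y where x: "x = c *\<^sub>R y" "c > 0" "y \<in> \<Omega>" by (auto simp: cone_over_def)
    have y: "y \<in> surface K" "y \<in> T" using x(3) T(2) by auto
    then have "K * form K x x = (K * K) * (c * c)"
      using surfaceD[OF K y(1)] K by (auto simp: x(1))
    then have f: "K * form K x x = c^2" using K by (auto simp: power2_eq_square)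
    then have "N x = y" using x(1,2) by (simp add: N_def)
    moreover have "x \<in> D" using f y(1) x(1,2) K by (auto simp: D_def surface_def)
    ultimately show "x \<in> D \<inter> N -` T" using y by simp
  qed
  finally show ?thesis .
qed

lemma geo_in_domain:
  assumes "r \<in> \<Omega>" "form K r v = 0" "form K v v = 1" "0 < t" "K = 1 \<longrightarrow> t < pi" "geo K r v t \<in> \<Omega>"
  shows "geo K r v ` {0..t} \<subseteq> \<Omega>"
proof -
  have "r \<in> surface K" using assms(1) domain_subset_surface by blast
  then have "geodesic_on K {0..t} (geo K r v)" using geodesic_on_geo[OF K] assms by blast
  then show ?thesis
    using convex[unfolded geodesically_convex_def, rule_format, of 0 t "geo K r v"] assms by simp
qed

lemma connect_in_domain:
  assumes "r \<in> \<Omega>" "q \<in> \<Omega>" "q \<noteq> r"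
  obtains v t where "form K r v = 0" "form K v v = 1" "0 < t" "K = 1 \<longrightarrow> t < pi" "geo K r v t = q"
    "geo K r v ` {0..t} \<subseteq> \<Omega>"
proof -
  have "q \<noteq> - r" using domain_not_antipodal assms(1,2) by blast
  then obtain v t where "form K r v = 0" "form K v v = 1" "0 < t" "K = 1 \<longrightarrow> t < pi" "geo K r v t = q"
    using geo_connect[OF K, of r q] assms domain_subset_surface by blast
  then show ?thesis using that geo_in_domain assms(1,2) by blast
qed

text \<open>Here geodesic convexity enters: a positive combination of two points of \<Omega> is a
  positive multiple of a point on the segment that joins them.\<close>

lemma cone_over_add:
  assumes "x \<in> cone_over \<Omega>" "y \<in> cone_over \<Omega>"
  shows "x + y \<in> cone_over \<Omega>"
proof -
  obtain a r b q where x: "x = a *\<^sub>R r" "a > 0" "r \<in> \<Omega>" and y: "y = b *\<^sub>R q" "b > 0" "q \<in> \<Omega>"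
    using assms by (auto simp: cone_over_def)
  show ?thesis
  proof (cases "q = r")
    case True
    then show ?thesis unfolding cone_over_def using x y
      by (intro CollectI exI[of _ "a + b"] exI[of _ r]) (simp add: scaleR_add_left)
  next
    case False
    obtain v t where vt: "0 < t" "K = 1 \<longrightarrow> t < pi" "geo K r v t = q" "geo K r v ` {0..t} \<subseteq> \<Omega>"
      using connect_in_domain[OF x(3) y(3) False] by metis
    obtain s c where "s \<in> {0..t}" "c > 0" "a *\<^sub>R r + b *\<^sub>R geo K r v t = c *\<^sub>R geo K r v s"
      using positive_combination_on_geo[OF K vt(1,2) x(2) y(2)] by metis
    moreover from this have "geo K r v s \<in> \<Omega>" using vt(4) by blast
    ultimately show ?thesis unfolding cone_over_def using vt(3) x(1) y(1) by blast
  qed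
qed

lemma convex_cone_over: "convex (cone_over \<Omega>)"
proof (rule convexI)
  fix x y and u v :: real
  assume "x \<in> cone_over \<Omega>" "y \<in> cone_over \<Omega>" "0 \<le> u" "0 \<le> v" "u + v = 1"
  then show "u *\<^sub>R x + v *\<^sub>R y \<in> cone_over \<Omega>"
    by (cases "u = 0"; cases "v = 0") (auto intro!: cone_over_add cone_over_scaleR)
qed

section \<open>Consequences of invariance along orbits\<close>

context
  fixes \<Phi> :: "real^3 \<Rightarrow> real^3 \<Rightarrow> real"
  assumes orbit_invariant: "\<forall>J c. billiard_orbit K \<Omega> J c \<longrightarrow>
    (\<forall>s\<in>J. \<forall>t\<in>J. c s \<in> \<Omega> \<longrightarrow> c t \<in> \<Omega> \<longrightarrow>
      \<Phi> (c s) (vector_derivative c (at s)) = \<Phi> (c t) (vector_derivative c (at t)))"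
begin

text \<open>Orbits are defined on open intervals, so [0, t] is embedded in the component J of the
  set of parameters at which the geodesic is in \<Omega>. No reflection happens on J.\<close>

lemma invariant_on_geo:
  assumes r: "r \<in> \<Omega>" and v: "form K r v = 0" "form K v v = 1"
    and t: "0 \<le> t" "geo K r v ` {0..t} \<subseteq> \<Omega>"
  shows "\<Phi> r v = \<Phi> (geo K r v t) (geo_velocity K r v t)"
proof -
  have rS: "r \<in> surface K" using r domain_subset_surface by blast
  obtain U where U: "open U" "\<Omega> = surface K \<inter> U"
    using open_domain by (auto simp: openin_open)
  define T where "T = {x. geo K r v x \<in> \<Omega>}"
  have "T = geo K r v -` U" using geo_surface[OF K rS v] by (auto simp: T_def U(2))
  then have "open T" using open_vimage[OF U(1) geo_continuous[OF K]] by simp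
  define J where "J = connected_component_set T 0"
  have "{0..t} \<subseteq> J" unfolding J_def
    using t by (intro connected_component_maximal) (auto simp: T_def)
  have JT: "J \<subseteq> T" unfolding J_def by (rule connected_component_subset)
  have "open J" unfolding J_def by (rule open_connected_component[OF \<open>open T\<close>])
  have "billiard_orbit K \<Omega> J (geo K r v)"
    unfolding billiard_orbit_def
  proof (intro conjI ballI impI)
    show "is_interval J" unfolding J_def is_interval_connected_1 by simp
    show "\<exists>\<delta>>0. geodesic_on K {x - \<delta><..<x + \<delta>} (geo K r v)" for x
      using geodesic_on_geo[OF K rS v] zero_less_one by blast
  next
    fix x assume "x \<in> J" "geo K r v x \<in> boundary K \<Omega>"
    then have False using JT boundary_disjoint[OF open_domain] by (auto simp: T_def)
    then show "\<exists>\<delta>>0. \<exists>w \<tau>. geo K r v ` ({x - \<delta><..<x + \<delta>} - {x}) \<subseteq> \<Omega> \<and>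
      geodesic_on K {x - \<delta><..x} (geo K r v) \<and> geodesic_on K {x..<x + \<delta>} (geo K r v) \<and>
      boundary_tangent K \<Omega> (geo K r v x) \<tau> \<and>
      (geo K r v has_vector_derivative w) (at_left x) \<and>
      (geo K r v has_vector_derivative reflect K \<tau> w) (at_right x)" ..
  qed (use \<open>open J\<close> JT geo_continuous[OF K] in \<open>auto simp: T_def\<close>)
  moreover have "0 \<in> J" "t \<in> J" "geo K r v t \<in> \<Omega>" using \<open>{0..t} \<subseteq> J\<close> t by auto
  ultimately show ?thesis
    using orbit_invariant[rule_format, of J "geo K r v" 0 t] r
    by (simp add: vector_derivative_at[OF geo_has_derivative[OF K]])
qed

text \<open>Both points lie in the plane orthogonal to the common momentum M, hence so does the
  segment of \<Omega> that joins them; by normalization its momentum is l M with l = 1 or l = -1.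
  For l = -1 the segment carries the reversed vectors -v and -w. Invariance along the segment and
  along its reversal covers both signs.\<close>

lemma even_part_determined_by_cross:
  assumes r: "(r, v) \<in> unit_tangent_bundle K \<Omega>" and q: "(q, w) \<in> unit_tangent_bundle K \<Omega>"
    and eq: "cross3 r v = cross3 q w"
  shows "even_part \<Phi> r v = even_part \<Phi> q w"
proof -
  have r: "r \<in> \<Omega>" "form K r v = 0" "form K v v = 1" and q: "q \<in> \<Omega>" "form K q w = 0" "form K w w = 1"
    using r q by (auto simp: unit_tangent_bundle_def)
  have S: "r \<in> surface K" "q \<in> surface K" using r q domain_subset_surface by auto
  show ?thesis
  proof (cases "q = r")
    case True
    then have "v = w" using tangent_from_cross[OF K S(1)] r(2) q(2) eq by metis
    then show ?thesis using True by simp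
  next
    case False
    define M where "M = cross3 r v"
    have rM: "r \<bullet> M = 0" "q \<bullet> M = 0" by (simp_all add: M_def dot_cross_self) (simp add: eq dot_cross_self)
    have "form K M M = K * K"
      using r surfaceD[OF K S(1)] by (simp add: M_def form_cross[OF K] form_commute[of K v r])
    then have M1: "form K M M = 1" using K by auto
    obtain u t where u: "form K r u = 0" "form K u u = 1" "0 < t" "K = 1 \<longrightarrow> t < pi"
      "geo K r u t = q" "geo K r u ` {0..t} \<subseteq> \<Omega>"
      using connect_in_domain[OF r(1) q(1) False] by metis
    define u' where "u' = geo_velocity K r u t"
    have "sinK K t *\<^sub>R u = q - cosK K t *\<^sub>R r"
      using u(5) by (auto simp: geo_def)
    then have "sinK K t * (u \<bullet> M) = 0"
      using rM by (metis (no_types) inner_diff_left inner_scaleR_left mult_zero_right diff_zero)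
    then have uM: "u \<bullet> M = 0" using sinK_pos[OF K u(3,4)] by simp
    have "cross3 M (cross3 r u) = 0"
      using rM uM by (simp add: Lagrange inner_commute)
    then have par: "(M \<bullet> M) *\<^sub>R cross3 r u = (M \<bullet> cross3 r u) *\<^sub>R M"
      by (rule zero_cross_imp_parallel)
    define l where "l = (M \<bullet> cross3 r u) / (M \<bullet> M)"
    have "M \<noteq> 0" using M1 by (auto simp: form_def)
    then have "cross3 r u = (1 / (M \<bullet> M)) *\<^sub>R (M \<bullet> M) *\<^sub>R cross3 r u" by simp
    then have l: "cross3 r u = l *\<^sub>R M" unfolding par by (simp add: l_def)
    have "form K (cross3 r u) (cross3 r u) = K * K"
      using u surfaceD[OF K S(1)] by (simp add: form_cross[OF K] form_commute[of K u r])
    then have "l * l = 1" using M1 K by (auto simp: l)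
    then have l1: "l = 1 \<or> l = -1" by (simp add: square_eq_1_iff)
    have u': "form K q u' = 0" "cross3 q u' = cross3 r u"
      using form_geo_velocity(2)[OF K S(1) u(1,2), of t] cross_geo[OF K, of r u t]
      by (simp_all add: u'_def u(5))
    have "u = l *\<^sub>R (K *\<^sub>R cross3 M (lower K r))"
      using tangent_from_cross[OF K S(1) u(1)] by (simp add: l cross_mult_left mult.commute)
    then have uv: "u = l *\<^sub>R v"
      unfolding M_def using tangent_from_cross[OF K S(1) r(2)] by metis
    have "u' = l *\<^sub>R (K *\<^sub>R cross3 M (lower K q))"
      using tangent_from_cross[OF K S(2) u'(1)] by (simp add: u'(2) l cross_mult_left mult.commute)
    then have uw: "u' = l *\<^sub>R w"
      unfolding M_def eq using tangent_from_cross[OF K S(2) q(2)] by metis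
    have "\<Phi> r u = \<Phi> q u'"
      using invariant_on_geo[OF r(1) u(1,2) _ u(6)] u(3,5) by (simp add: u'_def)
    moreover have "\<Phi> r (- u) = \<Phi> q (- u')"
    proof -
      have 1: "form K q (- u') = 0" "form K (- u') (- u') = 1"
        using u' form_geo_velocity(1)[OF K S(1) u(1,2)] by (simp_all add: u'_def)
      have 2: "geo K q (- u') x = geo K r u (t - x)" "geo_velocity K q (- u') x = - geo_velocity K r u (t - x)" for x
        using geo_reverse[OF K, of r u t x] by (simp_all add: u(5) u'_def)
      have "geo K q (- u') ` {0..t} \<subseteq> \<Omega>"
        using u(6) by (auto simp: 2)
      then show ?thesis
        using invariant_on_geo[OF q(1) 1, of t] u(3) by (simp add: 2)
    qed
    ultimately show ?thesis using l1 uv uw by (auto simp: even_part_def)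
  qed
qed

lemma even_part_eq_polynomial:
  assumes "polynomial_in_velocity K \<Omega> n \<Phi>" "even n" "\<Omega> \<noteq> {}"
  shows "\<exists>\<Psi>. homogeneous_polynomial n \<Psi> \<and>
    (\<forall>r v. (r, v) \<in> unit_tangent_bundle K \<Omega> \<longrightarrow> even_part \<Phi> r v = \<Psi> (cross3 r v))"
proof -
  obtain P where P: "\<And>r. r \<in> \<Omega> \<Longrightarrow> polynomial_le n (P r)"
    "\<And>r v. (r, v) \<in> unit_tangent_bundle K \<Omega> \<Longrightarrow> \<Phi> r v = P r v"
    using assms(1) unfolding polynomial_in_velocity_def by blast
  \<comment> \<open>One tangent vector is chosen for each momentum; the value does not depend on the
    choice because the momentum determines the even part.\<close>
  define G1 where "G1 N = (let z = SOME z. z \<in> unit_tangent_bundle K \<Omega> \<and> cross3 (fst z) (snd z) = N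
    in even_part \<Phi> (fst z) (snd z))" for N
  have G1: "G1 (cross3 r v) = even_part \<Phi> r v" if "(r, v) \<in> unit_tangent_bundle K \<Omega>" for r v
  proof -
    define z where "z = (SOME z. z \<in> unit_tangent_bundle K \<Omega> \<and> cross3 (fst z) (snd z) = cross3 r v)"
    have "z \<in> unit_tangent_bundle K \<Omega> \<and> cross3 (fst z) (snd z) = cross3 r v"
      unfolding z_def by (rule someI[of _ "(r, v)"]) (simp add: that)
    then have "even_part \<Phi> (fst z) (snd z) = even_part \<Phi> r v"
      using that by (intro even_part_determined_by_cross) auto
    then show ?thesis by (simp add: G1_def z_def)
  qed
  \<comment> \<open>Extension of \<open>G1\<close> by positive homogeneity of degree n. Only nonzero
    M orthogonal to a point of \<Omega> matter, and for these \<open>form K M M\<close> is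
    positive.\<close>
  define G where "G M = sqrt (form K M M) ^ n * G1 ((1 / sqrt (form K M M)) *\<^sub>R M)" for M
  have planes: "\<exists>H. homogeneous_polynomial n H \<and> (\<forall>M. M \<noteq> 0 \<longrightarrow> r \<bullet> M = 0 \<longrightarrow> G M = H M)"
    if r: "r \<in> \<Omega>" for r
  proof -
    have S: "r \<in> surface K" using r domain_subset_surface by blast
    obtain h where h: "homogeneous_polynomial n h"
      "\<And>v. form K v v = 1 \<Longrightarrow> h v = (P r v + P r (- v)) / 2"
      using polynomial_le_even_part[OF P(1)[OF r] assms(2), of K] by metis
    define L where "L M = K *\<^sub>R cross3 M (lower K r)" for M
    have "linear L" unfolding L_def
      by (intro linearI) (simp_all add: cross_add_left cross_mult_left algebra_simps)
    have "G M = h (L M)" if M: "M \<noteq> 0" "r \<bullet> M = 0" for M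
    proof -
      define v where "v = L M"
      have v: "form K r v = 0" "cross3 r v = M"
        using tangent_of_normal[OF K S M(2)] by (simp_all add: v_def L_def)
      then have "v \<noteq> 0" using M(1) by auto
      then have d: "form K v v > 0" using tangent_form_pos[OF K S v(1)] by blast
      have MM: "form K M M = form K v v"
        using K v(1) surfaceD[OF K S]
        by (auto simp: v(2)[symmetric] form_cross[OF K] form_commute[of K v r])
      define c where "c = 1 / sqrt (form K v v)"
      have c: "form K (c *\<^sub>R v) (c *\<^sub>R v) = 1" "c \<noteq> 0"
        using d by (simp_all add: c_def)
      have U: "(r, c *\<^sub>R v) \<in> unit_tangent_bundle K \<Omega>" "(r, - (c *\<^sub>R v)) \<in> unit_tangent_bundle K \<Omega>"
        using c(1) v(1) \<open>r \<in> \<Omega>\<close> by (simp_all add: unit_tangent_bundle_def)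
      have "G1 (c *\<^sub>R M) = even_part \<Phi> r (c *\<^sub>R v)"
        using G1[OF U(1)] by (simp add: cross_mult_right v(2))
      also have "\<dots> = h (c *\<^sub>R v)"
        using h(2)[OF c(1)] P(2)[OF U(1)] P(2)[OF U(2)] by (simp add: even_part_def)
      finally have "G M = (1 / c) ^ n * (c ^ n * h v)"
        by (simp add: G_def MM c_def homogeneous_polynomial_scaleR[OF h(1)])
      then show ?thesis using c(2) by (simp add: v_def power_one_over)
    qed
    then show ?thesis using homogeneous_polynomial_comp_linear[OF h(1) \<open>linear L\<close>] by blast
  qed
  have "cone_over \<Omega> \<noteq> {}" using subset_cone_over \<open>\<Omega> \<noteq> {}\<close> by blast
  moreover have "\<exists>H. homogeneous_polynomial n H \<and> (\<forall>M. M \<noteq> 0 \<longrightarrow> r \<bullet> M = 0 \<longrightarrow> G M = H M)"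
    if r: "r \<in> cone_over \<Omega>" for r
  proof -
    obtain c x where "r = c *\<^sub>R x" "c > 0" "x \<in> \<Omega>" using r by (auto simp: cone_over_def)
    then show ?thesis using planes[of x] by simp
  qed
  ultimately obtain \<Psi> where \<Psi>: "homogeneous_polynomial n \<Psi>"
    "\<And>r M. r \<in> cone_over \<Omega> \<Longrightarrow> M \<noteq> 0 \<Longrightarrow> r \<bullet> M = 0 \<Longrightarrow> G M = \<Psi> M"
    using homogeneous_polynomial_if_on_planes[OF open_cone_over _ zero_notin_cone_over, of n G] by blast
  have "even_part \<Phi> r v = \<Psi> (cross3 r v)" if U: "(r, v) \<in> unit_tangent_bundle K \<Omega>" for r v
  proof -
    have r: "r \<in> \<Omega>" "form K r v = 0" "form K v v = 1"
      using U by (auto simp: unit_tangent_bundle_def)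
    have M: "form K (cross3 r v) (cross3 r v) = 1"
      using K r surfaceD[OF K] domain_subset_surface
      by (auto simp: form_cross[OF K] form_commute[of K v r])
    then have "cross3 r v \<noteq> 0" by (auto simp: form_def)
    then have "G (cross3 r v) = \<Psi> (cross3 r v)"
      using \<Psi>(2)[of r "cross3 r v"] r(1) subset_cone_over by (auto simp: dot_cross_self)
    then show ?thesis using M G1[OF U] by (simp add: G_def)
  qed
  then show ?thesis using \<Psi>(1) by blast
qed

text \<open>Both w and w' point into \<Omega>. The orbit c arrives at p at time 0 along the geodesic
  of w traversed backwards, with velocity -w, and leaves with velocity w', the reflection of -w.
  This is the origin of both minus signs in the statement.\<close>

lemma invariant_under_reflection:
  assumes p: "p \<in> boundary K \<Omega>" "boundary_tangent K \<Omega> p \<tau>"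
    and w: "form K p w = 0" "form K w w = 1" and w': "form K p w' = 0" "form K w' w' = 1"
    and refl: "w' = - reflect K \<tau> w"
    and "\<delta> > 0" and inside: "\<And>t. t \<in> {0<..<\<delta>} \<Longrightarrow> geo K p w t \<in> \<Omega> \<and> geo K p w' t \<in> \<Omega>"
    and t: "t \<in> {0<..<\<delta>}"
  shows "\<Phi> (geo K p w t) (- geo_velocity K p w t) = \<Phi> (geo K p w' t) (geo_velocity K p w' t)"
proof -
  have S: "p \<in> surface K" using p(1) boundary_subset_surface by blast
  have nw: "form K p (- w) = 0" "form K (- w) (- w) = 1" using w by simp_all
  define c where "c x = (if x \<le> 0 then geo K p (- w) x else geo K p w' x)" for x
  have c0: "c 0 = p" by (simp add: c_def)
  have cl: "c x = geo K p (- w) x" if "x \<le> 0" for x using that by (simp add: c_def)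
  have cr: "c x = geo K p w' x" if "x \<ge> 0" for x using that by (cases "x = 0") (simp_all add: c_def)
  have in_domain: "c x \<in> \<Omega>" if "x \<in> {-\<delta><..<\<delta>}" "x \<noteq> 0" for x
  proof (cases "x > 0")
    case True
    then show ?thesis using inside[of x] that by (simp add: c_def)
  next
    case False
    then show ?thesis using inside[of "- x"] that geo_uminus[of K p "- w" x] by (simp add: c_def)
  qed
  have geod: "geodesic_on K A c" if "(\<forall>x\<in>A. x \<le> 0) \<or> (\<forall>x\<in>A. x \<ge> 0)" for A
    using that
  proof
    assume "\<forall>x\<in>A. x \<le> 0"
    then have "geodesic_on K A c = geodesic_on K A (geo K p (- w))"
      by (intro geodesic_on_cong) (simp add: cl)
    then show ?thesis using geodesic_on_geo[OF K S nw] by simp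
  next
    assume "\<forall>x\<in>A. x \<ge> 0"
    then have "geodesic_on K A c = geodesic_on K A (geo K p w')"
      by (intro geodesic_on_cong) (simp add: cr)
    then show ?thesis using geodesic_on_geo[OF K S w'] by simp
  qed
  have "billiard_orbit K \<Omega> {-\<delta><..<\<delta>} c"
    unfolding billiard_orbit_def
  proof (intro conjI ballI impI)
    show "continuous_on {-\<delta><..<\<delta>} c" unfolding c_def
      by (intro continuous_on_cases_le geo_continuous[OF K] continuous_intros) auto
    show "c ` {-\<delta><..<\<delta>} \<subseteq> \<Omega> \<union> boundary K \<Omega>"
      using in_domain p(1) c0 by (metis UnCI image_subsetI)
  next
    fix x assume "x \<in> {-\<delta><..<\<delta>}" "c x \<in> \<Omega>"
    then have "x \<noteq> 0" using c0 p(1) boundary_disjoint[OF open_domain] by auto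
    \<comment> \<open>The radius |x| keeps the interval on one side of 0, where the orbit is a
      single geodesic.\<close>
    then show "\<exists>d>0. geodesic_on K {x - d<..<x + d} c"
      by (intro exI[of _ "\<bar>x\<bar>"] conjI geod) auto
  next
    fix x assume x: "x \<in> {-\<delta><..<\<delta>}" "c x \<in> boundary K \<Omega>"
    then have [simp]: "x = 0" using in_domain boundary_disjoint[OF open_domain] by blast
    have image: "c ` ({-\<delta><..<\<delta>} - {0}) \<subseteq> \<Omega>"
      using in_domain by blast
    have "(c has_vector_derivative - w) (at_left 0)"
    proof -
      have "(geo K p (- w) has_vector_derivative - w) (at 0 within {..0})"
        using geo_has_derivative[OF K, of p "- w" 0] by simp
      then have "(c has_vector_derivative - w) (at 0 within {..0})"
        by (rule has_vector_derivative_transform[rotated 2]) (simp_all add: cl)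
      then show ?thesis by (rule has_vector_derivative_within_subset) auto
    qed
    moreover have "(c has_vector_derivative reflect K \<tau> (- w)) (at_right 0)"
    proof -
      have "(geo K p w' has_vector_derivative w') (at 0 within {0..})"
        using geo_has_derivative[OF K, of p w' 0] by simp
      then have "(c has_vector_derivative w') (at 0 within {0..})"
        by (rule has_vector_derivative_transform[rotated 2]) (simp_all add: cr)
      moreover have "reflect K \<tau> (- w) = w'" by (simp add: refl reflect_def)
      ultimately show ?thesis
        by (metis has_vector_derivative_within_subset Ioi_le_Ico)
    qed
    ultimately have "c ` ({x - \<delta><..<x + \<delta>} - {x}) \<subseteq> \<Omega> \<and>
        geodesic_on K {x - \<delta><..x} c \<and> geodesic_on K {x..<x + \<delta>} c \<and>
        boundary_tangent K \<Omega> (c x) \<tau> \<and>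
        (c has_vector_derivative - w) (at_left x) \<and>
        (c has_vector_derivative reflect K \<tau> (- w)) (at_right x)"
      using p(2) c0 image by (simp add: geod)
    then show "\<exists>d>0. \<exists>v \<tau>. c ` ({x - d<..<x + d} - {x}) \<subseteq> \<Omega> \<and>
        geodesic_on K {x - d<..x} c \<and> geodesic_on K {x..<x + d} c \<and>
        boundary_tangent K \<Omega> (c x) \<tau> \<and>
        (c has_vector_derivative v) (at_left x) \<and>
        (c has_vector_derivative reflect K \<tau> v) (at_right x)"
      using \<open>\<delta> > 0\<close> by blast
  qed auto
  moreover have "(c has_vector_derivative geo_velocity K p (- w) (- t)) (at (- t))"
    using t by (intro has_vector_derivative_transform_within_open[OF geo_has_derivative[OF K], where S = "{..<0}"])
      (auto simp: cl)
  moreover have "(c has_vector_derivative geo_velocity K p w' t) (at t)"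
    using t by (intro has_vector_derivative_transform_within_open[OF geo_has_derivative[OF K], where S = "{0<..}"])
      (auto simp: cr)
  moreover have "c (- t) = geo K p w t" "c t = geo K p w' t"
    using t geo_uminus[of K p w t] by (auto simp: cl cr)
  moreover have "geo_velocity K p (- w) (- t) = - geo_velocity K p w t"
    by (simp add: geo_velocity_def cosK_def sinK_def)
  ultimately show ?thesis
    using orbit_invariant[rule_format, of "{-\<delta><..<\<delta>}" c "- t" t] inside[OF t] t
    by (simp add: vector_derivative_at)
qed

text \<open>Reflection invariance is used twice, with w and w' exchanged, since each use relates
  only one of the two summands of the even part. Conservation of the momentum carries the equation
  from points of \<Omega> near p to p itself.\<close>

lemma polynomial_reflection_invariant:
  assumes p: "p \<in> boundary K \<Omega>" "boundary_tangent K \<Omega> p \<tau>"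
    and \<tau>: "form K p \<tau> = 0" "form K \<tau> \<tau> = 1" and w: "form K p w = 0" "form K w w = 1"
    and enters: "\<And>u. u \<in> {w, - reflect K \<tau> w} \<Longrightarrow> \<exists>t\<^sub>0>0. \<forall>t\<in>{0<..t\<^sub>0}. p + t *\<^sub>R u \<in> cone_over \<Omega>"
    and \<Psi>: "\<And>r v. (r, v) \<in> unit_tangent_bundle K \<Omega> \<Longrightarrow> even_part \<Phi> r v = \<Psi> (cross3 r v)"
  shows "\<Psi> (cross3 p w) = \<Psi> (cross3 p (- reflect K \<tau> w))"
proof -
  define w' where "w' = - reflect K \<tau> w"
  have S: "p \<in> surface K" using p(1) boundary_subset_surface by blast
  have w': "form K p w' = 0" "form K w' w' = 1" "w = - reflect K \<tau> w'"
    using \<tau> w by (simp_all add: w'_def reflect_def form_commute[of K \<tau> w] algebra_simps)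
  \<comment> \<open>The geodesic point is \<open>cosK K t\<close> times p + x u with x the quotient
    of \<open>sinK K t\<close> and \<open>cosK K t\<close>, a small positive number. So a straight
    ray that enters the cone forces the geodesic to enter \<Omega>.\<close>
  have geo_inside: "\<forall>\<^sub>F t in at_right 0. geo K p u t \<in> \<Omega>"
    if u: "form K p u = 0" "form K u u = 1" "\<exists>t\<^sub>0>0. \<forall>t\<in>{0<..t\<^sub>0}. p + t *\<^sub>R u \<in> cone_over \<Omega>" for u
  proof -
    obtain t0 where t0: "t0 > 0" "\<And>t. 0 < t \<Longrightarrow> t \<le> t0 \<Longrightarrow> p + t *\<^sub>R u \<in> cone_over \<Omega>"
      using u(3) by auto
    have cont: "isCont (cosK K) 0" "isCont (sinK K) 0"
      using has_derivative_cosK[OF K] has_derivative_sinK[OF K] DERIV_isCont by blast+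
    have lim: "(cosK K \<longlongrightarrow> 1) (at 0)" "(sinK K \<longlongrightarrow> 0) (at 0)"
      using cont by (simp_all add: isCont_def)
    have "((\<lambda>t. sinK K t / cosK K t) \<longlongrightarrow> 0 / 1) (at 0)"
      by (intro tendsto_divide lim) simp
    then have "\<forall>\<^sub>F t in at 0. cosK K t > 0" "\<forall>\<^sub>F t in at 0. sinK K t / cosK K t < t0"
      using t0(1) order_tendstoD(1)[OF lim(1), of 0] by (auto intro: order_tendstoD)
    then have "\<forall>\<^sub>F t in at_right 0. cosK K t > 0" "\<forall>\<^sub>F t in at_right 0. sinK K t / cosK K t < t0"
      by (simp_all add: eventually_at_split)
    moreover have "\<forall>\<^sub>F t in at_right 0. t \<in> {0<..<pi}"
      by (rule eventually_at_right_real) simp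
    ultimately show ?thesis
    proof eventually_elim
      case (elim t)
      have "sinK K t > 0" using elim sinK_pos[OF K] by simp
      then have "p + (sinK K t / cosK K t) *\<^sub>R u \<in> cone_over \<Omega>"
        using elim by (intro t0(2)) auto
      then have "cosK K t *\<^sub>R (p + (sinK K t / cosK K t) *\<^sub>R u) \<in> cone_over \<Omega>"
        using elim by (intro cone_over_scaleR)
      moreover have "cosK K t *\<^sub>R (p + (sinK K t / cosK K t) *\<^sub>R u) = geo K p u t"
        using elim by (simp add: geo_def scaleR_add_right)
      ultimately show ?case using cone_over_Int_surface geo_surface[OF K S u(1,2)] by simp
    qed
  qed
  have "\<forall>\<^sub>F t in at_right 0. geo K p w t \<in> \<Omega>" "\<forall>\<^sub>F t in at_right 0. geo K p w' t \<in> \<Omega>"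
    using geo_inside[OF w enters] geo_inside[OF w'(1,2) enters] by (simp_all add: w'_def)
  then have "\<forall>\<^sub>F t in at_right 0. geo K p w t \<in> \<Omega> \<and> geo K p w' t \<in> \<Omega>"
    by (rule eventually_conj)
  then obtain \<delta> where \<delta>: "\<delta> > 0" "\<And>t. t \<in> {0<..<\<delta>} \<Longrightarrow> geo K p w t \<in> \<Omega> \<and> geo K p w' t \<in> \<Omega>"
    by (auto simp: eventually_at_right_field)
  define t where "t = \<delta> / 2"
  have t: "t \<in> {0<..<\<delta>}" using \<delta>(1) by (simp add: t_def)
  have "\<Phi> (geo K p w t) (- geo_velocity K p w t) = \<Phi> (geo K p w' t) (geo_velocity K p w' t)"
    using invariant_under_reflection[OF p w w'(1,2) w'_def \<delta> t] .
  moreover have "\<Phi> (geo K p w' t) (- geo_velocity K p w' t) = \<Phi> (geo K p w t) (geo_velocity K p w t)"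
    by (rule invariant_under_reflection[OF p w'(1,2) w w'(3) \<delta>(1) _ t]) (simp add: \<delta>(2))
  ultimately have "even_part \<Phi> (geo K p w t) (geo_velocity K p w t)
      = even_part \<Phi> (geo K p w' t) (geo_velocity K p w' t)"
    by (simp add: even_part_def)
  moreover have "(geo K p u t, geo_velocity K p u t) \<in> unit_tangent_bundle K \<Omega>" if "u \<in> {w, w'}" for u
    using that \<delta>(2)[OF t] form_geo_velocity[OF K S] w w' by (auto simp: unit_tangent_bundle_def)
  ultimately show ?thesis
    using \<Psi> cross_geo[OF K] by (simp add: w'_def)
qed

end

end

section \<open>The dual curve\<close>

text \<open>A hyperplane separating the ray from the cone would support the cone along the arc, hence be
  tangent to it, so its normal would be a positive multiple of \<open>\<gamma> \<and> \<tau>\<close>.\<close>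

lemma ray_enters_convex_cone:
  fixes C :: "(real^3) set" and \<gamma> :: "real \<Rightarrow> real^3"
  assumes C: "open C" "convex C" "C \<noteq> {}" and cone: "\<And>x c. x \<in> C \<Longrightarrow> c > 0 \<Longrightarrow> c *\<^sub>R x \<in> C"
    and \<gamma>: "(\<gamma> has_vector_derivative \<tau>) (at s)" and U: "open U" "s \<in> U" "\<And>t. t \<in> U \<Longrightarrow> \<gamma> t \<in> closure C"
    and support: "\<And>x. x \<in> C \<Longrightarrow> cross3 (\<gamma> s) \<tau> \<bullet> x > 0" and w: "cross3 (\<gamma> s) \<tau> \<bullet> w > 0"
  shows "\<exists>t\<^sub>0>0. \<forall>t\<in>{0<..t\<^sub>0}. \<gamma> s + t *\<^sub>R w \<in> C"
proof -
  define p where "p = \<gamma> s"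
  define N where "N = cross3 p \<tau>"
  have "\<exists>t>0. p + t *\<^sub>R w \<in> C"
  proof (rule ccontr)
    define R where "R = (\<lambda>t. p + t *\<^sub>R w) ` {0<..}"
    assume "\<not> (\<exists>t>0. p + t *\<^sub>R w \<in> C)"
    then have "R \<inter> C = {}" by (auto simp: R_def)
    moreover have "R = (\<lambda>x. p + x) ` (\<lambda>t. t *\<^sub>R w) ` {0<..}" by (auto simp: R_def)
    then have "convex R"
      by (simp only: convex_translation_eq) (intro convex_linear_image convex_real_interval, simp)
    moreover have "R \<noteq> {}" by (auto simp: R_def)
    ultimately obtain a b where "a \<noteq> 0" and aR: "\<forall>x\<in>R. a \<bullet> x \<le> b" and aC: "\<forall>x\<in>C. a \<bullet> x \<ge> b"
      using separating_hyperplane_sets[of R C] C by metis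
    obtain q where q: "q \<in> C" using C(3) by blast
    \<comment> \<open>The cone is invariant under scaling, so the separating plane can be moved to
      the origin: small factors c give b \<le> 0, and large ones exclude a negative value of a on
      C.\<close>
    have scaled: "c * (a \<bullet> x) \<ge> b" if "c > 0" "x \<in> C" for c x
      using aC cone[OF that(2,1)] by (metis inner_scaleR_right)
    have "b \<le> 0"
    proof (rule ccontr)
      assume "\<not> b \<le> 0"
      then have "a \<bullet> q > 0" using scaled[of 1 q] q by simp
      then show False using scaled[of "b / (2 * (a \<bullet> q))" q] q \<open>\<not> b \<le> 0\<close> by simp
    qed
    have C0: "a \<bullet> x \<ge> 0" if "x \<in> C" for x
    proof (rule ccontr)
      assume "\<not> a \<bullet> x \<ge> 0"
      then show False
        using scaled[of "(b - 1) / (a \<bullet> x)" x] that \<open>b \<le> 0\<close> by (simp add: zero_less_divide_iff)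
    qed
    have "closure C \<subseteq> {x. a \<bullet> x \<ge> 0}"
      using C0 by (intro closure_minimal closed_halfspace_ge) auto
    then have clC: "a \<bullet> x \<ge> 0" if "x \<in> closure C" for x using that by blast
    have R0: "a \<bullet> p + t * (a \<bullet> w) \<le> 0" if "t > 0" for t
      using aR that \<open>b \<le> 0\<close> by (force simp: R_def inner_add_right)
    have "((\<lambda>t. a \<bullet> p + t * (a \<bullet> w)) \<longlongrightarrow> a \<bullet> p + 0 * (a \<bullet> w)) (at_right 0)"
      by (intro tendsto_intros)
    moreover have "\<forall>\<^sub>F t in at_right 0. a \<bullet> p + t * (a \<bullet> w) \<le> 0"
      using R0 by (auto simp: eventually_at_right_field intro: exI[of _ 1])
    ultimately have "a \<bullet> p \<le> 0" by (simp add: tendsto_upperbound)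
    then have ap: "a \<bullet> p = 0" using clC U by (simp add: p_def order_antisym)
    then have aw: "a \<bullet> w \<le> 0" using R0[of 1] by simp
    have "((\<lambda>t. a \<bullet> \<gamma> t) has_real_derivative a \<bullet> \<tau>) (at s)"
      using bounded_linear.has_vector_derivative[OF bounded_linear_inner_right \<gamma>, of a]
      by (simp add: has_real_derivative_iff_has_vector_derivative)
    moreover obtain d where "d > 0" "ball s d \<subseteq> U" using U by (meson openE)
    ultimately have a\<tau>: "a \<bullet> \<tau> = 0"
      using clC U(3) ap
      by (intro DERIV_local_min[of "\<lambda>t. a \<bullet> \<gamma> t" "a \<bullet> \<tau>" s d]) (auto simp: p_def dist_real_def subset_eq)
    \<comment> \<open>Strict, because C is open: q can be moved a little against a without leaving
      C.\<close>
    have "a \<bullet> q > 0"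
    proof -
      obtain e where e: "e > 0" "\<And>t. \<bar>t\<bar> < e \<Longrightarrow> q + t *\<^sub>R a \<in> C"
      proof -
        obtain e where "e > 0" "ball q e \<subseteq> C" using C(1) q by (meson openE)
        then show ?thesis using \<open>a \<noteq> 0\<close>
          by (intro that[of "e / norm a"]) (auto simp: subset_eq dist_norm field_simps)
      qed
      have "a \<bullet> (q + (- e / 2) *\<^sub>R a) \<ge> 0" using e by (intro C0 e(2)) auto
      then have "a \<bullet> q \<ge> e / 2 * (a \<bullet> a)" by (simp add: inner_diff_right)
      moreover have "e / 2 * (a \<bullet> a) > 0" using \<open>a \<noteq> 0\<close> e(1) by simp
      ultimately show ?thesis by linarith
    qed
    have "cross3 N a = 0"
      using cross_skew[of N a] ap a\<tau> by (simp add: N_def Lagrange)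
    then have par: "(N \<bullet> N) *\<^sub>R a = (N \<bullet> a) *\<^sub>R N" by (rule zero_cross_imp_parallel)
    have par: "(N \<bullet> N) * (a \<bullet> x) = (N \<bullet> a) * (N \<bullet> x)" for x
      using arg_cong[OF par, of "\<lambda>y. y \<bullet> x"] by simp
    have Nq: "N \<bullet> q > 0" using support q by (simp add: N_def p_def)
    then have "N \<noteq> 0" by auto
    then have "(N \<bullet> N) * (a \<bullet> q) > 0" using \<open>a \<bullet> q > 0\<close> by simp
    then have "N \<bullet> a > 0" using par[of q] Nq by (simp add: zero_less_mult_iff)
    moreover have "N \<bullet> w > 0" using w by (simp add: N_def p_def)
    ultimately have "(N \<bullet> N) * (a \<bullet> w) > 0" using par[of w] by simp
    then show False using aw mult_nonneg_nonpos[of "N \<bullet> N" "a \<bullet> w"] by simp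
  qed
  then obtain t\<^sub>0 where t0: "t\<^sub>0 > 0" "p + t\<^sub>0 *\<^sub>R w \<in> C" by blast
  have "p + t *\<^sub>R w \<in> C" if "0 < t" "t \<le> t\<^sub>0" for t
  proof -
    have "p - (t / t\<^sub>0) *\<^sub>R (p - (p + t\<^sub>0 *\<^sub>R w)) \<in> interior C"
      using t0 that C U by (intro mem_interior_closure_convex_shrink) (auto simp: interior_open p_def)
    then show ?thesis using t0 C(1) by (simp add: interior_open)
  qed
  then show ?thesis using t0(1) by (auto simp: p_def)
qed

lemma bounded_bilinear_form: "bounded_bilinear (form K)"
  unfolding bilinear_conv_bounded_bilinear[symmetric] bilinear_def
  by (intro conjI allI linearI) (simp_all add: algebra_simps)

lemma bounded_bilinear_cross3: "bounded_bilinear cross3"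
  using bilinear_cross bilinear_conv_bounded_bilinear by blast

lemma form_constant_imp_orthogonal:
  assumes "(f has_vector_derivative f') (at t within I)" "\<And>x. x \<in> I \<Longrightarrow> form K (f x) (f x) = c"
    and "t \<in> I" "at t within I \<noteq> bot"
  shows "form K (f t) f' = 0"
proof -
  have "((\<lambda>x. form K (f x) (f x)) has_vector_derivative form K (f t) f' + form K f' (f t)) (at t within I)"
    by (rule bounded_bilinear.has_vector_derivative[OF bounded_bilinear_form assms(1,1)])
  moreover have "((\<lambda>x. form K (f x) (f x)) has_vector_derivative 0) (at t within I)"
    using assms(2,3) by (intro has_vector_derivative_transform[OF _ _ has_vector_derivative_const[of c]]) auto
  ultimately show ?thesis
    using vector_derivative_unique_within[OF assms(4)] form_commute[of K f' "f t"] by fastforce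
qed

lemma at_within_interval_neq_bot:
  fixes I :: "real set"
  assumes "is_interval I" "interior I \<noteq> {}" "t \<in> I"
  shows "at t within I \<noteq> bot"
proof -
  have "I \<noteq> {a}" for a using assms(2) by (auto simp: interior_singleton)
  then show ?thesis
    using connected_imp_perfect[of I t] assms by (auto simp: trivial_limit_within is_interval_connected_1)
qed

lemma even_part_nonconstant:
  assumes "polynomial_integral K \<Omega> n \<Phi>" "even n"
  shows "\<exists>r v. (r, v) \<in> unit_tangent_bundle K \<Omega> \<and> even_part \<Phi> r v \<noteq> c"
proof (rule ccontr)
  assume *: "\<not> ?thesis"
  have "polynomial_in_velocity K \<Omega> n \<Phi>" using assms(1) by (simp add: polynomial_integral_def)
  then obtain P where P: "\<And>r. r \<in> \<Omega> \<Longrightarrow> polynomial_le n (P r)"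
    "\<And>r v. (r, v) \<in> unit_tangent_bundle K \<Omega> \<Longrightarrow> \<Phi> r v = P r v"
    unfolding polynomial_in_velocity_def by blast
  have even_c: "\<Phi> r v = (P r v - P r (- v)) / 2 + c" if U: "(r, v) \<in> unit_tangent_bundle K \<Omega>" for r v
  proof -
    have "(r, - v) \<in> unit_tangent_bundle K \<Omega>" using U by (simp add: unit_tangent_bundle_def)
    moreover have "even_part \<Phi> r v = c" using * U by blast
    ultimately show ?thesis using P(2)[OF U] P(2)[of r "- v"] by (simp add: even_part_def field_simps)
  qed
  show False
  proof (cases "n = 0")
    \<comment> \<open>No degree below 0 is available for a contradiction; here the odd part
      vanishes, so \<Phi> itself would be constant.\<close>
    case True
    have "\<Phi> r v = c" if U: "(r, v) \<in> unit_tangent_bundle K \<Omega>" for r v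
    proof -
      have "polynomial_le 0 (P r)" using P(1)[of r] U True by (simp add: unit_tangent_bundle_def)
      then have "P r v = P r (- v)" by (auto simp: polynomial_le_def)
      then show ?thesis using even_c[OF U] by simp
    qed
    then have "\<exists>C. \<forall>(r, v)\<in>unit_tangent_bundle K \<Omega>. \<Phi> r v = C"
      by (intro exI[of _ c]) auto
    then show False using assms(1) by (simp add: polynomial_integral_def)
  next
    case False
    have "polynomial_in_velocity K \<Omega> (n - 1) \<Phi>"
      unfolding polynomial_in_velocity_def
      using polynomial_le_odd_part[OF P(1) assms(2), of _ c] False even_c
      by (intro exI[of _ "\<lambda>r v. (P r v - P r (- v)) / 2 + c"]) auto
    then show False using assms(1) False by (simp add: polynomial_integral_def)
  qed
qed

text \<open>The part \<open>w\<^sub>0\<close> of \<kappa> tangent to \<Sigma> is normal to the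
  boundary. The vector \<tau> + y \<open>w\<^sub>0\<close> has momentum \<Gamma> + y \<Gamma>', and
  the vector y \<open>w\<^sub>0\<close> - \<tau> matched with it has momentum -(\<Gamma> - y
  \<Gamma>'); normalization contributes the same factor m > 0 to both. Homogeneity and evenness of n
  remove m and the sign.\<close>

lemma reflection_symmetric_at_interior:
  assumes K: "K \<in> {1, -1}" and convex: "convex_domain K \<Omega>"
    and arc: "boundary_arc K \<Omega> I \<gamma>" "positively_oriented \<Omega> I \<gamma>"
    and integral: "polynomial_integral K \<Omega> n \<Phi>" and n: "even n"
    and \<Psi>: "homogeneous_polynomial n \<Psi>"
      "\<And>r v. (r, v) \<in> unit_tangent_bundle K \<Omega> \<Longrightarrow> even_part \<Phi> r v = \<Psi> (cross3 r v)"
    and s: "s \<in> interior I"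
    and \<gamma>: "(\<gamma> has_vector_derivative \<tau>) (at s)" and p: "p = \<gamma> s"
    and \<tau>: "form K p \<tau> = 0" "form K \<tau> \<tau> = 1" "form K \<tau> \<kappa> = 0"
  shows "\<Psi> (cross3 p \<tau> + y *\<^sub>R cross3 p \<kappa>) = \<Psi> (cross3 p \<tau> - y *\<^sub>R cross3 p \<kappa>)"
proof -
  have sI: "s \<in> I" using s interior_subset by blast
  have at: "at s within I = at s" using s by (rule at_within_interior)
  have vd: "vector_derivative \<gamma> (at s within I) = \<tau>" using \<gamma> by (simp add: at vector_derivative_at)
  have dual: "dual_curve I \<gamma> s = cross3 p \<tau>" by (simp add: dual_curve_def vd p)
  have pos: "\<forall>x\<in>\<Omega>. cross3 p \<tau> \<bullet> x > 0"
    using arc(2) sI by (auto simp: positively_oriented_def dual)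
  have dom: "\<Omega> \<noteq> {}" "openin (top_of_set (surface K)) \<Omega>" "geodesically_convex K \<Omega>"
    using convex by (auto simp: convex_domain_def)
  note D = K dom(2,3) pos
  have orb: "\<forall>J c. billiard_orbit K \<Omega> J c \<longrightarrow>
    (\<forall>s\<in>J. \<forall>t\<in>J. c s \<in> \<Omega> \<longrightarrow> c t \<in> \<Omega> \<longrightarrow>
      \<Phi> (c s) (vector_derivative c (at s)) = \<Phi> (c t) (vector_derivative c (at t)))"
    using integral unfolding polynomial_integral_def by (elim conjE)
  have \<gamma>b: "\<gamma> t \<in> boundary K \<Omega>" if "t \<in> I" for t
    using arc(1) that by (auto simp: boundary_arc_def)
  have pb: "p \<in> boundary K \<Omega>" using \<gamma>b sI by (simp add: p)
  then have S: "p \<in> surface K" using boundary_subset_surface by blast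
  have bt: "boundary_tangent K \<Omega> p \<tau>"
    unfolding boundary_tangent_def using arc(1) s p vd by blast
  \<comment> \<open>Subtracting a multiple of p makes \<kappa> tangent to \<Sigma> and leaves its
    vector product with p unchanged.\<close>
  define w\<^sub>0 where "w\<^sub>0 = \<kappa> - (K * form K p \<kappa>) *\<^sub>R p"
  have w0: "form K p w\<^sub>0 = 0" "form K \<tau> w\<^sub>0 = 0" "cross3 p w\<^sub>0 = cross3 p \<kappa>"
    using K surfaceD[OF K S] \<tau> form_commute[of K \<tau> p]
    by (auto simp: w\<^sub>0_def Cross3.right_diff_distrib cross_mult_right)
  have enters: "\<exists>t\<^sub>0>0. \<forall>t\<in>{0<..t\<^sub>0}. p + t *\<^sub>R u \<in> cone_over \<Omega>" if "cross3 p \<tau> \<bullet> u > 0" for u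
    unfolding p
  proof (rule ray_enters_convex_cone[OF open_cone_over[OF D] convex_cone_over[OF D] _ cone_over_scaleR \<gamma>])
    show "cone_over \<Omega> \<noteq> {}" using subset_cone_over dom(1) by blast
    show "open (interior I)" "s \<in> interior I" using s by auto
    show "\<gamma> t \<in> closure (cone_over \<Omega>)" if "t \<in> interior I" for t
      using \<gamma>b[of t] that interior_subset boundary_subset_closure closure_mono[OF subset_cone_over] by blast
    show "cross3 (\<gamma> s) \<tau> \<bullet> x > 0" if "x \<in> cone_over \<Omega>" for x
      using cone_over_hemisphere[OF D that] by (simp add: p)
  qed (use that in \<open>simp_all add: p\<close>)
  have main: "\<Psi> (cross3 p \<tau> + y *\<^sub>R cross3 p \<kappa>) = \<Psi> (cross3 p \<tau> - y *\<^sub>R cross3 p \<kappa>)"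
    if y: "y * (cross3 p \<tau> \<bullet> w\<^sub>0) > 0" for y
  proof -
    define u where "u = \<tau> + y *\<^sub>R w\<^sub>0"
    have uu: "form K u u = 1 + y * (y * form K w\<^sub>0 w\<^sub>0)"
      using \<tau>(2) w0(2) form_commute[of K w\<^sub>0 \<tau>] by (simp add: u_def algebra_simps)
    have pu: "form K p u = 0" using \<tau> w0 by (simp add: u_def)
    have "form K \<tau> u = 1" using \<tau> w0 by (simp add: u_def)
    then have "u \<noteq> 0" by (auto simp: form_def)
    then have d: "form K u u > 0" using tangent_form_pos[OF K S pu] by blast
    define m where "m = 1 / sqrt (form K u u)"
    define w where "w = m *\<^sub>R u"
    have m: "m > 0" using d by (simp add: m_def)
    have w: "form K p w = 0" "form K w w = 1" using d pu by (simp_all add: w_def m_def)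
    have w': "- reflect K \<tau> w = m *\<^sub>R (y *\<^sub>R w\<^sub>0 - \<tau>)"
    proof -
      have "form K w \<tau> = m" using \<open>form K \<tau> u = 1\<close> form_commute[of K u \<tau>] by (simp add: w_def)
      then have "reflect K \<tau> w = (2 * m) *\<^sub>R \<tau> - w" by (simp add: reflect_def)
      then show ?thesis unfolding w_def u_def by (simp add: vec_eq_iff algebra_simps)
    qed
    have "\<Psi> (cross3 p w) = \<Psi> (cross3 p (- reflect K \<tau> w))"
    proof (rule polynomial_reflection_invariant[OF D orb pb bt \<tau>(1,2) w _ \<Psi>(2)])
      fix u' assume "u' \<in> {w, - reflect K \<tau> w}"
      then have "cross3 p \<tau> \<bullet> u' = m * (y * (cross3 p \<tau> \<bullet> w\<^sub>0))"
        unfolding w' by (auto simp: w_def u_def inner_add_right inner_diff_right dot_cross_self)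
      then show "\<exists>t\<^sub>0>0. \<forall>t\<in>{0<..t\<^sub>0}. p + t *\<^sub>R u' \<in> cone_over \<Omega>"
        using y m by (intro enters) simp
    qed
    also have "cross3 p w = m *\<^sub>R (cross3 p \<tau> + y *\<^sub>R cross3 p \<kappa>)"
      by (simp add: w_def u_def cross_mult_right cross_add_right w0(3))
    also have "cross3 p (- reflect K \<tau> w) = (- m) *\<^sub>R (cross3 p \<tau> - y *\<^sub>R cross3 p \<kappa>)"
      unfolding w' by (simp add: cross_mult_right Cross3.right_diff_distrib w0(3) algebra_simps)
    finally show ?thesis
      using m n by (simp add: homogeneous_polynomial_scaleR[OF \<Psi>(1)] del: scaleR_minus_left)
  qed
  \<comment> \<open>The matched vectors point into \<Omega> for one sign of y only; for the other
    sign the claim is the same equation read backwards.\<close>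
  consider "y * (cross3 p \<tau> \<bullet> w\<^sub>0) > 0" | "(- y) * (cross3 p \<tau> \<bullet> w\<^sub>0) > 0" | "y = 0" | "cross3 p \<tau> \<bullet> w\<^sub>0 = 0"
    by (metis linorder_neqE_linordered_idom mult_eq_0_iff mult_minus_left neg_0_less_iff_less)
  then show ?thesis
  proof cases
    case 1
    then show ?thesis by (rule main)
  next
    case 2
    then show ?thesis using main[OF 2] by simp
  next
    case 3
    then show ?thesis by simp
  next
    \<comment> \<open>Zero geodesic curvature: \<open>w\<^sub>0\<close> lies in the plane of p and
      \<tau> and is orthogonal to both for \<open>form K\<close>, so \<Gamma>' is 0 and both sides
      coincide.\<close>
    case 4
    define M where "M = cross3 p w\<^sub>0"
    define N where "N = cross3 p \<tau>"
    have "M \<bullet> \<tau> = 0" using 4 cross_triple[of p w\<^sub>0 \<tau>] cross_triple[of p \<tau> w\<^sub>0] cross_skew[of w\<^sub>0 \<tau>]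
      by (simp add: M_def inner_commute)
    then have "cross3 N M = 0"
      using cross_skew[of N M] by (simp add: N_def Lagrange M_def dot_cross_self)
    then have par: "(N \<bullet> N) *\<^sub>R M = (N \<bullet> M) *\<^sub>R N" by (rule zero_cross_imp_parallel)
    have "form K N N = 1" "form K N M = 0"
      using K \<tau> w0 surfaceD[OF K S] form_commute[of K \<tau> p]
      by (auto simp: N_def M_def form_cross[OF K])
    then have "N \<bullet> M = 0" "N \<noteq> 0"
      using arg_cong[OF par, of "form K N"] by (simp, auto simp: form_def)
    then have "M = 0" using par by simp
    then show ?thesis using w0(3) by (simp add: M_def)
  qed
qed

lemma even_along_line_imp_derivative_zero:
  assumes \<Psi>: "homogeneous_polynomial n \<Psi>" and g: "(g has_vector_derivative v) (at t within I)"
    and even: "\<And>x. \<Psi> (g t + x *\<^sub>R v) = \<Psi> (g t - x *\<^sub>R v)"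
  shows "((\<lambda>t. \<Psi> (g t)) has_vector_derivative 0) (at t within I)"
proof -
  obtain L where L: "(\<Psi> has_derivative L) (at (g t))"
    using homogeneous_polynomial_differentiable[OF \<Psi>] by (auto simp: differentiable_def)
  have line: "((\<lambda>x. \<Psi> (g t + x *\<^sub>R w)) has_vector_derivative L w) (at 0)" for w
  proof -
    have "((\<lambda>x. g t + x *\<^sub>R w) has_vector_derivative w) (at 0)"
      by (auto intro!: derivative_eq_intros)
    then have "((\<lambda>x. \<Psi> (g t + x *\<^sub>R w)) has_derivative (\<lambda>x. L (x *\<^sub>R w))) (at 0)"
      using has_derivative_compose[of "\<lambda>x. g t + x *\<^sub>R w" "\<lambda>x. x *\<^sub>R w" 0 UNIV \<Psi> L] L
      by (simp add: has_vector_derivative_def)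
    moreover have "L (x *\<^sub>R w) = x *\<^sub>R L w" for x
      using L has_derivative_linear linear_scale by blast
    ultimately show ?thesis by (simp add: has_vector_derivative_def)
  qed
  have "L v = L (- v)"
    using line[of v] line[of "- v"] even by (simp add: vector_derivative_unique_at)
  moreover have "L (- v) = - L v" using L has_derivative_linear linear_neg by blast
  ultimately have "L v = 0" by simp
  moreover have "L (x *\<^sub>R v) = x *\<^sub>R L v" for x
    using L has_derivative_linear linear_scale by blast
  ultimately show ?thesis
    using has_derivative_compose[OF g[unfolded has_vector_derivative_def] L]
    by (simp add: has_vector_derivative_def)
qed

text \<open>Reflection gives the symmetry at interior parameters only; this extends it by continuity
  to endpoints belonging to I.\<close>

lemma zero_on_interior_imp_zero:
  fixes f :: "real \<Rightarrow> real"
  assumes "is_interval I" "interior I \<noteq> {}" "continuous_on I f"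
    and zero: "\<And>t. t \<in> interior I \<Longrightarrow> f t = 0" and "t \<in> I"
  shows "f t = 0"
proof -
  have "t \<in> closure (interior I)"
    using convex_closure_interior[of I] assms(1,2,5) closure_subset by (auto simp: is_interval_convex)
  then obtain u where u: "\<And>k. u k \<in> interior I" "u \<longlonglongrightarrow> t"
    by (auto simp: closure_sequential)
  moreover have "u k \<in> I" for k using u(1) interior_subset by blast
  ultimately have "(\<lambda>k. f (u k)) \<longlonglongrightarrow> f t"
    using assms(5) by (intro continuous_on_tendsto_compose[OF assms(3)]) auto
  then show ?thesis by (simp add: zero[OF u(1)] LIMSEQ_const_iff)
qed

theorem theorem1p3:
  fixes K :: real and \<Omega> :: "(real^3) set" and I :: "real set" and \<gamma> :: "real \<Rightarrow> real^3"
    and \<Phi> :: "real^3 \<Rightarrow> real^3 \<Rightarrow> real" and n :: nat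
  assumes "K \<in> {1, -1}"
    and "convex_domain K \<Omega>"
    and "boundary_arc K \<Omega> I \<gamma>"
    and "positively_oriented \<Omega> I \<gamma>"
    and "\<not> geodesic_on K I \<gamma>"
    and "polynomial_integral K \<Omega> n \<Phi>"
    and "even n"
  shows "\<exists>\<Psi>. homogeneous_polynomial n \<Psi> \<and> (\<exists>x. \<Psi> x \<noteq> 0) \<and>
    (\<forall>s\<in>I. \<Psi> (dual_curve I \<gamma> s) = 0) \<and>
    (\<forall>s\<in>I. \<forall>w \<in> span {vector_derivative (dual_curve I \<gamma>) (at s within I)}. w \<noteq> 0 \<longrightarrow>
       (\<forall>\<^sub>F \<epsilon> in nhds 0. \<Psi> (dual_curve I \<gamma> s - \<epsilon> *\<^sub>R w) = \<Psi> (dual_curve I \<gamma> s + \<epsilon> *\<^sub>R w)))"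
proof -
  note K = assms(1)
  have I: "is_interval I" "interior I \<noteq> {}" and \<gamma>b: "\<gamma> ` I \<subseteq> boundary K \<Omega>"
    and unit: "\<And>s. s \<in> I \<Longrightarrow> form K (vector_derivative \<gamma> (at s within I)) (vector_derivative \<gamma> (at s within I)) = 1"
    using assms(3) by (auto simp: boundary_arc_def)
  have lim: "at t within I \<noteq> bot" if "t \<in> I" for t
    using at_within_interval_neq_bot[OF I that] .
  obtain D where D0: "D 0 = \<gamma>"
    and D: "\<And>k t. t \<in> I \<Longrightarrow> (D k has_vector_derivative D (Suc k) t) (at t within I)"
    using assms(3) unfolding boundary_arc_def smooth_curve_def by blast
  define \<tau> \<kappa> where "\<tau> = D 1" and "\<kappa> = D 2"
  have \<gamma>': "(\<gamma> has_vector_derivative \<tau> t) (at t within I)"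
    and \<tau>': "(\<tau> has_vector_derivative \<kappa> t) (at t within I)" if "t \<in> I" for t
    using D[OF that, of 0] D[OF that, of 1] by (simp_all add: D0 \<tau>_def \<kappa>_def numeral_2_eq_2)
  have vd: "vector_derivative \<gamma> (at t within I) = \<tau> t" if "t \<in> I" for t
    using vector_derivative_within[OF lim[OF that] \<gamma>'[OF that]] .
  have S: "\<gamma> t \<in> surface K" if "t \<in> I" for t
    using \<gamma>b boundary_subset_surface that by blast
  have \<tau>\<tau>: "form K (\<tau> t) (\<tau> t) = 1" if "t \<in> I" for t
    using unit[OF that] by (simp add: vd[OF that])
  have \<gamma>\<tau>: "form K (\<gamma> t) (\<tau> t) = 0" if "t \<in> I" for t
    using form_constant_imp_orthogonal[OF \<gamma>'[OF that] _ that lim[OF that]] S surfaceD[OF K] by blast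
  have \<tau>\<kappa>: "form K (\<tau> t) (\<kappa> t) = 0" if "t \<in> I" for t
    using form_constant_imp_orthogonal[OF \<tau>'[OF that] _ that lim[OF that]] \<tau>\<tau> by blast
  define \<Gamma> \<Gamma>' where "\<Gamma> t = cross3 (\<gamma> t) (\<tau> t)" and "\<Gamma>' t = cross3 (\<gamma> t) (\<kappa> t)" for t
  have dual: "dual_curve I \<gamma> t = \<Gamma> t" if "t \<in> I" for t
    by (simp add: dual_curve_def vd[OF that] \<Gamma>_def)
  have \<Gamma>_deriv: "(\<Gamma> has_vector_derivative \<Gamma>' t) (at t within I)" if "t \<in> I" for t
    using bounded_bilinear.has_vector_derivative[OF bounded_bilinear_cross3 \<gamma>'[OF that] \<tau>'[OF that]]
    by (simp add: \<Gamma>_def[abs_def] \<Gamma>'_def)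
  have vd_dual: "vector_derivative (dual_curve I \<gamma>) (at t within I) = \<Gamma>' t" if "t \<in> I" for t
  proof -
    have "(dual_curve I \<gamma> has_vector_derivative \<Gamma>' t) (at t within I)"
      by (rule has_vector_derivative_transform[OF that dual \<Gamma>_deriv[OF that]])
    then show ?thesis by (rule vector_derivative_within[OF lim[OF that]])
  qed
  \<comment> \<open>These values give Q(\<Gamma> + x \<Gamma>') = 1 + x^2 Q(\<Gamma>'), so that
    subtracting a multiple of a power of Q preserves the symmetry.\<close>
  have form_\<Gamma>: "form K (\<Gamma> t) (\<Gamma> t) = 1" "form K (\<Gamma> t) (\<Gamma>' t) = 0" if "t \<in> I" for t
    using K S[OF that] \<tau>\<tau>[OF that] \<gamma>\<tau>[OF that] \<tau>\<kappa>[OF that] form_commute[of K "\<tau> t" "\<gamma> t"]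
      surfaceD[OF K S[OF that]]
    by (auto simp: \<Gamma>_def \<Gamma>'_def form_cross[OF K])
  obtain s0 where "s0 \<in> I" using I(2) interior_subset by blast
  then have hemi: "\<forall>x\<in>\<Omega>. \<Gamma> s0 \<bullet> x > 0"
    using assms(4) dual by (auto simp: positively_oriented_def)
  have dom: "\<Omega> \<noteq> {}" "openin (top_of_set (surface K)) \<Omega>" "geodesically_convex K \<Omega>"
    using assms(2) by (auto simp: convex_domain_def)
  have orb: "\<forall>J c. billiard_orbit K \<Omega> J c \<longrightarrow>
    (\<forall>s\<in>J. \<forall>t\<in>J. c s \<in> \<Omega> \<longrightarrow> c t \<in> \<Omega> \<longrightarrow>
      \<Phi> (c s) (vector_derivative c (at s)) = \<Phi> (c t) (vector_derivative c (at t)))"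
    using assms(6) unfolding polynomial_integral_def by (elim conjE)
  have "polynomial_in_velocity K \<Omega> n \<Phi>" using assms(6) by (simp add: polynomial_integral_def)
  then obtain P where P: "homogeneous_polynomial n P"
    "\<And>r v. (r, v) \<in> unit_tangent_bundle K \<Omega> \<Longrightarrow> even_part \<Phi> r v = P (cross3 r v)"
    using even_part_eq_polynomial[OF K dom(2,3) hemi orb _ assms(7) dom(1)] by blast
  have contP: "continuous_on A (\<lambda>t. P (f t))" if "continuous_on A f" for A and f :: "real \<Rightarrow> real^3"
  proof -
    have "continuous_on UNIV P"
      using homogeneous_polynomial_differentiable[OF P(1)]
      by (intro continuous_at_imp_continuous_on ballI differentiable_imp_continuous_within)
    then show ?thesis using that by (rule continuous_on_compose2) auto
  qed
  have sym: "P (\<Gamma> t + x *\<^sub>R \<Gamma>' t) = P (\<Gamma> t - x *\<^sub>R \<Gamma>' t)" if "t \<in> I" for t x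
  proof -
    have cont: "continuous_on I \<Gamma>" "continuous_on I \<Gamma>'"
    proof -
      have Dc: "continuous_on I (D k)" for k
        unfolding continuous_on_eq_continuous_within using D has_vector_derivative_continuous by blast
      show "continuous_on I \<Gamma>" "continuous_on I \<Gamma>'"
        unfolding \<Gamma>_def[abs_def] \<Gamma>'_def[abs_def] \<tau>_def \<kappa>_def D0[symmetric]
        by (intro continuous_on_cross Dc)+
    qed
    have "P (\<Gamma> t + x *\<^sub>R \<Gamma>' t) - P (\<Gamma> t - x *\<^sub>R \<Gamma>' t) = 0"
    proof (rule zero_on_interior_imp_zero[OF I _ _ that])
      show "continuous_on I (\<lambda>t. P (\<Gamma> t + x *\<^sub>R \<Gamma>' t) - P (\<Gamma> t - x *\<^sub>R \<Gamma>' t))"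
        by (intro continuous_intros contP cont)
      fix u assume u: "u \<in> interior I"
      then have uI: "u \<in> I" using interior_subset by blast
      have "(\<gamma> has_vector_derivative \<tau> u) (at u)"
        using \<gamma>'[OF uI] at_within_interior[OF u] by simp
      from reflection_symmetric_at_interior[OF K assms(2-4,6,7) P u this refl \<gamma>\<tau>[OF uI] \<tau>\<tau>[OF uI] \<tau>\<kappa>[OF uI]]
      show "P (\<Gamma> u + x *\<^sub>R \<Gamma>' u) - P (\<Gamma> u - x *\<^sub>R \<Gamma>' u) = 0"
        by (simp add: \<Gamma>_def \<Gamma>'_def)
    qed
    then show ?thesis by simp
  qed
  have "((\<lambda>t. P (\<Gamma> t)) has_vector_derivative 0) (at t within I)" if "t \<in> I" for t
    using even_along_line_imp_derivative_zero[OF P(1) \<Gamma>_deriv[OF that] sym[OF that]] .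
  then obtain c where c: "\<And>t. t \<in> I \<Longrightarrow> P (\<Gamma> t) = c"
    using has_vector_derivative_zero_constant[of I "\<lambda>t. P (\<Gamma> t)"] I(1) is_interval_convex by metis
  define \<Psi> where "\<Psi> M = P M + (- c) * form K M M ^ (n div 2)" for M
  have "2 * (n div 2) = n" using \<open>even n\<close> by simp
  then have h\<Psi>: "homogeneous_polynomial n \<Psi>"
    unfolding \<Psi>_def using homogeneous_polynomial_power[OF homogeneous_polynomial_form, of "n div 2" K]
    by (intro homogeneous_polynomial_add homogeneous_polynomial_cmult P(1)) simp
  \<comment> \<open>At the momentum of a unit vector the form is 1, so \<Psi> takes there the value
    of the even part minus c.\<close>
  obtain r v where rv: "(r, v) \<in> unit_tangent_bundle K \<Omega>" "even_part \<Phi> r v \<noteq> c"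
    using even_part_nonconstant[OF assms(6,7)] by blast
  then have "r \<in> surface K" "form K r v = 0" "form K v v = 1"
    using openin_imp_subset[OF dom(2)] by (auto simp: unit_tangent_bundle_def)
  then have "form K (cross3 r v) (cross3 r v) = 1"
    using K surfaceD[OF K] by (auto simp: form_cross[OF K] form_commute[of K v r])
  then have nz: "\<Psi> (cross3 r v) \<noteq> 0" using rv P(2)[OF rv(1)] by (simp add: \<Psi>_def)
  have \<Psi>_sym: "\<Psi> (\<Gamma> t - x *\<^sub>R \<Gamma>' t) = \<Psi> (\<Gamma> t + x *\<^sub>R \<Gamma>' t)" if "t \<in> I" for t x
    using sym[OF that, of x] form_\<Gamma>[OF that] form_commute[of K "\<Gamma>' t" "\<Gamma> t"] by (simp add: \<Psi>_def)
  have "\<forall>\<^sub>F \<epsilon> in nhds 0. \<Psi> (dual_curve I \<gamma> t - \<epsilon> *\<^sub>R w) = \<Psi> (dual_curve I \<gamma> t + \<epsilon> *\<^sub>R w)"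
    if t: "t \<in> I" and w: "w \<in> span {vector_derivative (dual_curve I \<gamma>) (at t within I)}" for t w
  proof -
    \<comment> \<open>Tangent vectors are multiples of \<Gamma>', and the symmetry holds for every
      \<epsilon>, not only for small ones.\<close>
    obtain y where "w = y *\<^sub>R \<Gamma>' t" using w by (auto simp: vd_dual[OF t] span_singleton)
    then show ?thesis
      using \<Psi>_sym[OF t] by (simp add: dual[OF t])
  qed
  moreover have "\<Psi> (dual_curve I \<gamma> t) = 0" if "t \<in> I" for t
    using c[OF that] form_\<Gamma>(1)[OF that] by (simp add: dual[OF that] \<Psi>_def)
  ultimately show ?thesis using h\<Psi> nz by blast
qed

end
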